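(* Let $R$ be a commutative ring and let $\mathcal{U}\subseteq G$ be a subset of a group $G$. The following assertions are equivalent: (1) $\mathcal{U}$ is ring-supporting. (2) For every $G$-graded $R$-algebra $A=\bigoplus_{g\in G}A_g$, the sub-bimodule $A_{\mathcal{U}}=\bigoplus_{u\in\mathcal{U}}A_u$ has a structure of $G$-graded $R$-algebra by putting $(A_{\mathcal{U}})_g=0$ when $g\in G\setminus\mathcal{U}$ (and $(A_{\mathcal{U}})_u=A_u$ for $u\in\mathcal{U}$) and considering the support-restricted multiplication.
   Context: All algebras are associative with unit. A subset $\mathcal{U}$ of a group $G$ is ring-supporting if $1\in\mathcal{U}$ and, whenever $u,v,w\in\mathcal{U}$ satisfy $uvw\in\mathcal{U}$, one has $uv\in\mathcal{U}$ if and only if $vw\in\mathcal{U}$. The support-restricted multiplication on $A_{\mathcal{U}}$ is the operation defined on nonzero homogeneous elements $a,b$ of $A_{\mathcal{U}}$ by $a\cdot b=ab$ (the product in $A$) if $\deg(a)\deg(b)\in\mathcal{U}$, and $a\cdot b=0$ otherwise, and then extended by linearity.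
   Formalization: R is assumed nonzero and unital algebras are required to have 1 ≠ 0; over the zero ring (2) holds for every subset U, and if the zero algebra were allowed, the empty U would satisfy (2) but not (1). *)

theory Defs
  imports "HOL-Algebra.Algebra"
begin

text \<open>
  The locale \<^locale>\<open>algebra\<close> of HOL-Algebra requires a commutative multiplication. Here
  algebras are associative and unital, but not necessarily commutative. As usual for unital
  algebras, \<open>1 \<noteq> 0\<close> is part of the definition: if the zero algebra counted as unital, then all the
  submodules \<open>A\<^sub>U\<close> below would be unital for \<open>U = {}\<close>, although the empty set does not contain
  the neutral element.
\<close>

locale unital_algebra = module R A + ring A for R (structure) and A (structure) +
  assumes smult_mult_left:
      "\<lbrakk>r \<in> carrier R; x \<in> carrier A; y \<in> carrier A\<rbrakk> \<Longrightarrow>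
        (r \<odot>\<^bsub>A\<^esub> x) \<otimes>\<^bsub>A\<^esub> y = r \<odot>\<^bsub>A\<^esub> (x \<otimes>\<^bsub>A\<^esub> y)"
    and smult_mult_right:
      "\<lbrakk>r \<in> carrier R; x \<in> carrier A; y \<in> carrier A\<rbrakk> \<Longrightarrow>
        x \<otimes>\<^bsub>A\<^esub> (r \<odot>\<^bsub>A\<^esub> y) = r \<odot>\<^bsub>A\<^esub> (x \<otimes>\<^bsub>A\<^esub> y)"
    and one_neq_zero: "\<one>\<^bsub>A\<^esub> \<noteq> \<zero>\<^bsub>A\<^esub>"

text \<open>
  \<open>f\<close> is a family of homogeneous components, almost all of them zero, with sum \<open>x\<close>. The
  condition outside \<open>carrier G\<close> only serves to make \<open>f\<close> unique as a HOL function.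
\<close>

definition homogeneous_decomposition ::
    "('g, 'm) monoid_scheme \<Rightarrow> ('r, 'a, 'n) module_scheme \<Rightarrow> ('g \<Rightarrow> 'a set) \<Rightarrow> 'a \<Rightarrow> ('g \<Rightarrow> 'a) \<Rightarrow> bool"
  where "homogeneous_decomposition G A \<A> x f \<longleftrightarrow>
    (\<forall>g\<in>carrier G. f g \<in> \<A> g) \<and> (\<forall>g. g \<notin> carrier G \<longrightarrow> f g = \<zero>\<^bsub>A\<^esub>) \<and>
    finite {g. f g \<noteq> \<zero>\<^bsub>A\<^esub>} \<and> x = (\<Oplus>\<^bsub>A\<^esub>g\<in>{g. f g \<noteq> \<zero>\<^bsub>A\<^esub>}. f g)"

text \<open>
  \<open>A = \<Oplus>\<^sub>g A\<^sub>g\<close> as an internal direct sum of \<open>R\<close>-submodules, with \<open>A\<^sub>g A\<^sub>h \<subseteq> A\<^bsub>gh\<^esub>\<close>. That the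
  unit lies in the component of the neutral element is a consequence.
\<close>

locale graded_algebra = group G + unital_algebra R A
  for G (structure) and R (structure) and A (structure) and \<A> +
  assumes component_submodule: "g \<in> carrier G \<Longrightarrow> submodule (\<A> g) R A"
    and direct_sum: "x \<in> carrier A \<Longrightarrow> \<exists>!f. homogeneous_decomposition G A \<A> x f"
    and component_mult:
      "\<lbrakk>g \<in> carrier G; h \<in> carrier G; x \<in> \<A> g; y \<in> \<A> h\<rbrakk> \<Longrightarrow> x \<otimes>\<^bsub>A\<^esub> y \<in> \<A> (g \<otimes>\<^bsub>G\<^esub> h)"

definition ring_supporting :: "('g, 'm) monoid_scheme \<Rightarrow> 'g set \<Rightarrow> bool"
  where "ring_supporting G U \<longleftrightarrow>
    \<one>\<^bsub>G\<^esub> \<in> U \<and>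
    (\<forall>u\<in>U. \<forall>v\<in>U. \<forall>w\<in>U. u \<otimes>\<^bsub>G\<^esub> v \<otimes>\<^bsub>G\<^esub> w \<in> U \<longrightarrow> (u \<otimes>\<^bsub>G\<^esub> v \<in> U \<longleftrightarrow> v \<otimes>\<^bsub>G\<^esub> w \<in> U))"

definition component ::
    "('g, 'm) monoid_scheme \<Rightarrow> ('r, 'a, 'n) module_scheme \<Rightarrow> ('g \<Rightarrow> 'a set) \<Rightarrow> 'a \<Rightarrow> 'g \<Rightarrow> 'a"
  where "component G A \<A> x = (THE f. homogeneous_decomposition G A \<A> x f)"

definition homogeneous_support ::
    "('g, 'm) monoid_scheme \<Rightarrow> ('r, 'a, 'n) module_scheme \<Rightarrow> ('g \<Rightarrow> 'a set) \<Rightarrow> 'a \<Rightarrow> 'g set"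
  where "homogeneous_support G A \<A> x = {g \<in> carrier G. component G A \<A> x g \<noteq> \<zero>\<^bsub>A\<^esub>}"

text \<open>The degree is meaningful for nonzero homogeneous elements only.\<close>

definition hdeg :: "('g, 'm) monoid_scheme \<Rightarrow> ('g \<Rightarrow> 'a set) \<Rightarrow> 'a \<Rightarrow> 'g"
  where "hdeg G \<A> a = (THE g. g \<in> carrier G \<and> a \<in> \<A> g)"

definition homogeneous_restricted_mult ::
    "('g, 'm) monoid_scheme \<Rightarrow> ('r, 'a, 'n) module_scheme \<Rightarrow> ('g \<Rightarrow> 'a set) \<Rightarrow> 'g set \<Rightarrow> 'a \<Rightarrow> 'a \<Rightarrow> 'a"
  where "homogeneous_restricted_mult G A \<A> U a b =
    (if hdeg G \<A> a \<otimes>\<^bsub>G\<^esub> hdeg G \<A> b \<in> U then a \<otimes>\<^bsub>A\<^esub> b else \<zero>\<^bsub>A\<^esub>)"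

text \<open>
  The extension by linearity: both arguments are expanded into their finitely many nonzero
  homogeneous components.
\<close>

definition restricted_mult ::
    "('g, 'm) monoid_scheme \<Rightarrow> ('r, 'a, 'n) module_scheme \<Rightarrow> ('g \<Rightarrow> 'a set) \<Rightarrow> 'g set \<Rightarrow> 'a \<Rightarrow> 'a \<Rightarrow> 'a"
  where "restricted_mult G A \<A> U x y =
    (\<Oplus>\<^bsub>A\<^esub>g\<in>homogeneous_support G A \<A> x. \<Oplus>\<^bsub>A\<^esub>h\<in>homogeneous_support G A \<A> y.
      homogeneous_restricted_mult G A \<A> U (component G A \<A> x g) (component G A \<A> y h))"

definition restricted_carrier ::
    "('r, 'a, 'n) module_scheme \<Rightarrow> ('g \<Rightarrow> 'a set) \<Rightarrow> 'g set \<Rightarrow> 'a set"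
  where "restricted_carrier A \<A> U =
    {\<Oplus>\<^bsub>A\<^esub>u\<in>F. f u | F f. finite F \<and> F \<subseteq> U \<and> (\<forall>u\<in>F. f u \<in> \<A> u)}"

text \<open>
  \<open>A\<^sub>U\<close> with the support-restricted multiplication. An HOL-Algebra record has to name a unit, so
  the candidate \<open>e\<close> is a parameter.
\<close>

definition support_restriction ::
    "('g, 'm) monoid_scheme \<Rightarrow> ('r, 'a) module \<Rightarrow> ('g \<Rightarrow> 'a set) \<Rightarrow> 'g set \<Rightarrow> 'a \<Rightarrow> ('r, 'a) module"
  where "support_restriction G A \<A> U e =
    \<lparr>carrier = restricted_carrier A \<A> U,
     monoid.mult = restricted_mult G A \<A> U, one = e,
     ring.zero = \<zero>\<^bsub>A\<^esub>, add = (\<oplus>\<^bsub>A\<^esub>), smult = (\<odot>\<^bsub>A\<^esub>)\<rparr>"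

definition restricted_grading ::
    "('r, 'a, 'n) module_scheme \<Rightarrow> ('g \<Rightarrow> 'a set) \<Rightarrow> 'g set \<Rightarrow> 'g \<Rightarrow> 'a set"
  where "restricted_grading A \<A> U g = (if g \<in> U then \<A> g else {\<zero>\<^bsub>A\<^esub>})"

text \<open>
  For every graded algebra with underlying set in the type \<open>'a\<close>, the support-restricted
  multiplication makes \<open>A\<^sub>U\<close> a graded algebra. The type is a parameter because HOL formulas
  cannot quantify over types.
\<close>

definition restrictions_graded ::
    "'a itself \<Rightarrow> ('g, 'm) monoid_scheme \<Rightarrow> ('r, 'n) ring_scheme \<Rightarrow> 'g set \<Rightarrow> bool"
  where "restrictions_graded _ G R U \<longleftrightarrow>
    (\<forall>(A :: ('r, 'a) module) \<A>. graded_algebra G R A \<A> \<longrightarrow>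
      (\<exists>e. graded_algebra G R (support_restriction G A \<A> U e) (restricted_grading A \<A> U)))"

end

(* Since deg(a) deg(b) is the degree of ab, the support-restricted product of arbitrary x and y is
   the projection of xy onto A_U. Hence bilinearity and the unit laws are inherited from A, and
   associativity only has to be checked on homogeneous elements, where it is the ring-supporting
   condition. Conversely, in the group algebra R[G] every product of basis elements is a nonzero
   basis element, so associativity of the restriction forces the condition on u, v, w. The neutral
   element belongs to U because the unit of a graded algebra is homogeneous of neutral degree. *)

theory Submission
  imports Defs
begin

text \<open>\<open>restricted_mult\<close> is a double sum over supports with degrees chosen by a
  description operator, a form in which no ring law can be checked directly. Rewriting it as the
  projection of the ordinary product removes both the degrees and the sums. In the second assertion
  the unit \<open>e\<close> of the restriction is only known to exist, so the converse may not
  assume that it is the unit of \<open>A\<close>. Homogeneity of the unit is therefore proved for an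
  arbitrary graded algebra and used twice: for \<open>A\<close>, to place its unit in
  \<open>A_U\<close>, and for the restriction, to obtain that the neutral element lies in
  \<open>U\<close>. A single test algebra, R[G], suffices for the converse. It has nonzero basis
  elements only if 1 and 0 differ in \<open>R\<close>. Over the zero ring every module is zero, so
  there would be no unital algebra at all, and the second assertion would hold vacuously even for
  empty \<open>U\<close>.\<close>

section \<open>Finite sums in abelian monoids and a submodule criterion\<close>

lemma (in abelian_monoid) finsum_mono_neutral_left:
  assumes "finite B" "A \<subseteq> B" "\<And>i. i \<in> B - A \<Longrightarrow> f i = \<zero>" "f \<in> B \<rightarrow> carrier G"
  shows "finsum G f A = finsum G f B"
  using add.finprod_mono_neutral_cong_left[OF assms(1,2), of f f] assms(3,4) by blast

text \<open>Finiteness of the index sets is not assumed: a \<open>finsum\<close> over an infinite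
  set is zero by convention, which makes both sides agree. The lemma exchanges the two convolution
  sums in the associativity of R[G].\<close>

lemma (in abelian_monoid) finsum_swap:
  assumes "\<And>i j. i \<in> I \<Longrightarrow> j \<in> J \<Longrightarrow> f i j \<in> carrier G"
  shows "(\<Oplus>i\<in>I. \<Oplus>j\<in>J. f i j) = (\<Oplus>j\<in>J. \<Oplus>i\<in>I. f i j)"
  using assms
proof (induction I rule: infinite_finite_induct)
  case (insert i I)
  have "(\<Oplus>j\<in>J. \<Oplus>i\<in>insert i I. f i j) = (\<Oplus>j\<in>J. f i j \<oplus> (\<Oplus>i\<in>I. f i j))"
    by (rule finsum_cong') (use insert in \<open>auto simp: Pi_iff intro!: finsum_closed finsum_insert\<close>)
  also have "\<dots> = (\<Oplus>j\<in>J. f i j) \<oplus> (\<Oplus>j\<in>J. \<Oplus>i\<in>I. f i j)"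
    by (rule finsum_addf) (use insert in \<open>auto intro!: finsum_closed\<close>)
  finally show ?case
    using insert by (simp add: Pi_iff finsum_closed)
qed auto

text \<open>\<open>A\<close> and \<open>B\<close> are separate records, possibly on overlapping
  carriers. The lemma serves for component maps and projections, for coefficients of the group
  algebra, and, with \<open>\<phi>\<close> the identity, for moving sums from the restricted algebra
  back to the original one.\<close>

lemma finsum_additive:
  assumes "abelian_monoid A" "abelian_monoid B"
    and "\<And>x. x \<in> carrier A \<Longrightarrow> \<phi> x \<in> carrier B"
    and "\<And>x y. x \<in> carrier A \<Longrightarrow> y \<in> carrier A \<Longrightarrow> \<phi> (x \<oplus>\<^bsub>A\<^esub> y) = \<phi> x \<oplus>\<^bsub>B\<^esub> \<phi> y"
    and "\<phi> \<zero>\<^bsub>A\<^esub> = \<zero>\<^bsub>B\<^esub>"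
    and "f \<in> I \<rightarrow> carrier A"
  shows "\<phi> (\<Oplus>\<^bsub>A\<^esub>i\<in>I. f i) = (\<Oplus>\<^bsub>B\<^esub>i\<in>I. \<phi> (f i))"
proof -
  interpret A: abelian_monoid A by fact
  interpret B: abelian_monoid B by fact
  show ?thesis
    using assms(6)
    by (induction I rule: infinite_finite_induct) (auto simp: assms(3-5) Pi_iff A.finsum_closed)
qed

text \<open>Negatives are scalar multiples by -1, so closure under scalars covers them.\<close>

lemma (in module) submoduleI':
  assumes "H \<subseteq> carrier M" "\<zero>\<^bsub>M\<^esub> \<in> H"
    and "\<And>x y. \<lbrakk>x \<in> H; y \<in> H\<rbrakk> \<Longrightarrow> x \<oplus>\<^bsub>M\<^esub> y \<in> H"
    and "\<And>r x. \<lbrakk>r \<in> carrier R; x \<in> H\<rbrakk> \<Longrightarrow> r \<odot>\<^bsub>M\<^esub> x \<in> H"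
  shows "submodule H R M"
proof (rule submoduleI)
  fix x assume x: "x \<in> H"
  then have "\<ominus>\<^bsub>M\<^esub> x = (\<ominus>\<^bsub>R\<^esub> \<one>\<^bsub>R\<^esub>) \<odot>\<^bsub>M\<^esub> x"
    using assms(1) by (subst smult_l_minus) auto
  then show "\<ominus>\<^bsub>M\<^esub> x \<in> H" using x assms(4) by simp
qed (use assms in auto)

lemma ring_supportingD:
  assumes "ring_supporting G U" "u \<in> U" "v \<in> U" "w \<in> U" "u \<otimes>\<^bsub>G\<^esub> v \<otimes>\<^bsub>G\<^esub> w \<in> U"
  shows "u \<otimes>\<^bsub>G\<^esub> v \<in> U \<longleftrightarrow> v \<otimes>\<^bsub>G\<^esub> w \<in> U"
  using assms(1)[unfolded ring_supporting_def, THEN conjunct2, THEN bspec, OF assms(2),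
      THEN bspec, OF assms(3), THEN bspec, OF assms(4), THEN mp, OF assms(5)] .

section \<open>Homogeneous components and the projection onto \<open>A\<^sub>U\<close>\<close>

text \<open>In \<^locale>\<open>graded_algebra\<close> the facts about \<open>G\<close>, \<open>R\<close> and \<open>A\<close> shadow one another; here they are
  qualified.\<close>

locale grading = G: group G + R: cring R + A: ring A
  for G :: "('g, 'm) monoid_scheme" and R :: "('r, 'k) ring_scheme"
    and A :: "('r, 'a, 'n) module_scheme" +
  fixes \<A> :: "'g \<Rightarrow> 'a set"
  assumes graded: "graded_algebra G R A \<A>"
begin

lemma smult_closed [simp]: "\<lbrakk>r \<in> carrier R; x \<in> carrier A\<rbrakk> \<Longrightarrow> r \<odot>\<^bsub>A\<^esub> x \<in> carrier A"
  and smult_zero [simp]: "r \<in> carrier R \<Longrightarrow> r \<odot>\<^bsub>A\<^esub> \<zero>\<^bsub>A\<^esub> = \<zero>\<^bsub>A\<^esub>"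
  and smult_mult_left:
    "\<lbrakk>r \<in> carrier R; x \<in> carrier A; y \<in> carrier A\<rbrakk> \<Longrightarrow>
      (r \<odot>\<^bsub>A\<^esub> x) \<otimes>\<^bsub>A\<^esub> y = r \<odot>\<^bsub>A\<^esub> (x \<otimes>\<^bsub>A\<^esub> y)"
  and smult_mult_right:
    "\<lbrakk>r \<in> carrier R; x \<in> carrier A; y \<in> carrier A\<rbrakk> \<Longrightarrow>
      x \<otimes>\<^bsub>A\<^esub> (r \<odot>\<^bsub>A\<^esub> y) = r \<odot>\<^bsub>A\<^esub> (x \<otimes>\<^bsub>A\<^esub> y)"
  and one_neq_zero: "\<one>\<^bsub>A\<^esub> \<noteq> \<zero>\<^bsub>A\<^esub>"
  and is_module: "module R A"
  and component_mult:
    "\<lbrakk>g \<in> carrier G; h \<in> carrier G; x \<in> \<A> g; y \<in> \<A> h\<rbrakk> \<Longrightarrow> x \<otimes>\<^bsub>A\<^esub> y \<in> \<A> (g \<otimes>\<^bsub>G\<^esub> h)"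
proof -
  interpret gr: graded_algebra G R A \<A> by (rule graded)
  show "module R A" ..
  show "\<lbrakk>r \<in> carrier R; x \<in> carrier A\<rbrakk> \<Longrightarrow> r \<odot>\<^bsub>A\<^esub> x \<in> carrier A"
    and "r \<in> carrier R \<Longrightarrow> r \<odot>\<^bsub>A\<^esub> \<zero>\<^bsub>A\<^esub> = \<zero>\<^bsub>A\<^esub>"
    using module.smult_r_null[OF \<open>module R A\<close>] module.smult_closed[OF \<open>module R A\<close>] by auto
qed (use graded_algebra.component_mult[OF graded] graded in
    \<open>auto simp: graded_algebra_def unital_algebra_def unital_algebra_axioms_def\<close>)

lemma submodule: "g \<in> carrier G \<Longrightarrow> submodule (\<A> g) R A"
  using graded_algebra.component_submodule[OF graded] .

lemma component_closed: "\<lbrakk>g \<in> carrier G; x \<in> \<A> g\<rbrakk> \<Longrightarrow> x \<in> carrier A"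
  using module.submoduleE(1)[OF is_module submodule] by blast

lemma component_zero: "g \<in> carrier G \<Longrightarrow> \<zero>\<^bsub>A\<^esub> \<in> \<A> g"
  using subgroup.one_closed[OF submodule.axioms(1)[OF submodule]] by simp

lemma component_add:
  "\<lbrakk>g \<in> carrier G; x \<in> \<A> g; y \<in> \<A> g\<rbrakk> \<Longrightarrow> x \<oplus>\<^bsub>A\<^esub> y \<in> \<A> g"
  using module.submoduleE(5)[OF is_module submodule] .

lemma component_smult: "\<lbrakk>g \<in> carrier G; r \<in> carrier R; x \<in> \<A> g\<rbrakk> \<Longrightarrow> r \<odot>\<^bsub>A\<^esub> x \<in> \<A> g"
  using module.submoduleE(4)[OF is_module submodule] .

section \<open>Components and supports of an element\<close>

abbreviation "hom_comp \<equiv> component G A \<A>"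
abbreviation "hom_supp \<equiv> homogeneous_support G A \<A>"

lemma decomposition_hom_comp:
  assumes "x \<in> carrier A" shows "homogeneous_decomposition G A \<A> x (hom_comp x)"
  unfolding component_def using graded_algebra.direct_sum[OF graded assms] by (rule theI')

lemma hom_comp_eqI:
  assumes "x \<in> carrier A" "homogeneous_decomposition G A \<A> x f" shows "hom_comp x = f"
  using graded_algebra.direct_sum[OF graded assms(1)] assms decomposition_hom_comp by blast

lemma hom_comp_mem: "\<lbrakk>x \<in> carrier A; g \<in> carrier G\<rbrakk> \<Longrightarrow> hom_comp x g \<in> \<A> g"
  using decomposition_hom_comp unfolding homogeneous_decomposition_def by blast

lemma hom_comp_outside: "\<lbrakk>x \<in> carrier A; g \<notin> carrier G\<rbrakk> \<Longrightarrow> hom_comp x g = \<zero>\<^bsub>A\<^esub>"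
  using decomposition_hom_comp unfolding homogeneous_decomposition_def by blast

lemma hom_comp_closed [simp]: "x \<in> carrier A \<Longrightarrow> hom_comp x g \<in> carrier A"
  using hom_comp_mem hom_comp_outside component_closed by (cases "g \<in> carrier G") auto

lemma hom_supp_eq: "x \<in> carrier A \<Longrightarrow> hom_supp x = {g. hom_comp x g \<noteq> \<zero>\<^bsub>A\<^esub>}"
  using hom_comp_outside by (auto simp: homogeneous_support_def)

lemma finite_hom_supp: "x \<in> carrier A \<Longrightarrow> finite (hom_supp x)"
  using decomposition_hom_comp hom_supp_eq unfolding homogeneous_decomposition_def by simp

lemma hom_supp_subset: "hom_supp x \<subseteq> carrier G"
  by (auto simp: homogeneous_support_def)

text \<open>\<open>F\<close> is left free so that two elements can be expanded over a common index
  set; the additional components are zero.\<close>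

lemma sum_hom_comp:
  assumes "x \<in> carrier A" "finite F" "hom_supp x \<subseteq> F"
  shows "(\<Oplus>\<^bsub>A\<^esub>g\<in>F. hom_comp x g) = x"
proof -
  have "x = (\<Oplus>\<^bsub>A\<^esub>g\<in>hom_supp x. hom_comp x g)"
    using decomposition_hom_comp[OF assms(1)] hom_supp_eq[OF assms(1)]
    unfolding homogeneous_decomposition_def by simp
  also have "\<dots> = (\<Oplus>\<^bsub>A\<^esub>g\<in>F. hom_comp x g)"
    by (rule A.finsum_mono_neutral_left) (use assms in \<open>auto simp: hom_supp_eq\<close>)
  finally show ?thesis by simp
qed

text \<open>Cutting \<open>f\<close> off to zero outside \<open>F\<close> gives a decomposition of
  the sum, and decompositions are unique. Linearity of the components rests on this.\<close>

lemma hom_comp_sum: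
  assumes F: "finite F" "F \<subseteq> carrier G" and f: "\<And>g. g \<in> F \<Longrightarrow> f g \<in> \<A> g"
  shows "hom_comp (\<Oplus>\<^bsub>A\<^esub>g\<in>F. f g) = (\<lambda>g. if g \<in> F then f g else \<zero>\<^bsub>A\<^esub>)" (is "_ = ?f")
proof (rule hom_comp_eqI)
  have cl: "f \<in> F \<rightarrow> carrier A" using component_closed F f by blast
  then show "(\<Oplus>\<^bsub>A\<^esub>g\<in>F. f g) \<in> carrier A" by (rule A.finsum_closed)
  have sub: "{g. ?f g \<noteq> \<zero>\<^bsub>A\<^esub>} \<subseteq> F" by auto
  have "(\<Oplus>\<^bsub>A\<^esub>g\<in>{g. ?f g \<noteq> \<zero>\<^bsub>A\<^esub>}. ?f g) = (\<Oplus>\<^bsub>A\<^esub>g\<in>F. ?f g)"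
    by (rule A.finsum_mono_neutral_left) (use F sub cl in auto)
  also have "\<dots> = (\<Oplus>\<^bsub>A\<^esub>g\<in>F. f g)"
    by (rule A.finsum_cong') (use cl in auto)
  finally show "homogeneous_decomposition G A \<A> (\<Oplus>\<^bsub>A\<^esub>g\<in>F. f g) ?f"
    unfolding homogeneous_decomposition_def
    using F f finite_subset[OF sub F(1)] by (auto simp: component_zero)
qed

lemma hom_comp_homogeneous:
  assumes "u \<in> carrier G" "a \<in> \<A> u"
  shows "hom_comp a = (\<lambda>g. if g = u then a else \<zero>\<^bsub>A\<^esub>)"
  using hom_comp_sum[of "{u}" "\<lambda>_. a"] assms component_closed[OF assms] by simp

lemma hom_comp_zero [simp]: "hom_comp \<zero>\<^bsub>A\<^esub> g = \<zero>\<^bsub>A\<^esub>"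
  using hom_comp_homogeneous[of "\<one>\<^bsub>G\<^esub>"] component_zero by auto

lemma hom_comp_add:
  assumes "x \<in> carrier A" "y \<in> carrier A"
  shows "hom_comp (x \<oplus>\<^bsub>A\<^esub> y) g = hom_comp x g \<oplus>\<^bsub>A\<^esub> hom_comp y g"
proof -
  let ?F = "hom_supp x \<union> hom_supp y"
  have F: "finite ?F" "?F \<subseteq> carrier G"
    using assms finite_hom_supp hom_supp_subset by auto
  have "x \<oplus>\<^bsub>A\<^esub> y = (\<Oplus>\<^bsub>A\<^esub>g\<in>?F. hom_comp x g) \<oplus>\<^bsub>A\<^esub> (\<Oplus>\<^bsub>A\<^esub>g\<in>?F. hom_comp y g)"
    using sum_hom_comp F assms by simp
  also have "\<dots> = (\<Oplus>\<^bsub>A\<^esub>g\<in>?F. hom_comp x g \<oplus>\<^bsub>A\<^esub> hom_comp y g)"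
    by (rule A.finsum_addf[symmetric]) (use assms in auto)
  finally have eq: "x \<oplus>\<^bsub>A\<^esub> y = (\<Oplus>\<^bsub>A\<^esub>g\<in>?F. hom_comp x g \<oplus>\<^bsub>A\<^esub> hom_comp y g)" .
  have "hom_comp (x \<oplus>\<^bsub>A\<^esub> y) =
      (\<lambda>g. if g \<in> ?F then hom_comp x g \<oplus>\<^bsub>A\<^esub> hom_comp y g else \<zero>\<^bsub>A\<^esub>)"
    unfolding eq by (rule hom_comp_sum[OF F]) (use assms F in \<open>auto intro!: component_add hom_comp_mem\<close>)
  then show ?thesis using assms by (auto simp: hom_supp_eq)
qed

lemma hom_comp_smult:
  assumes "x \<in> carrier A" "r \<in> carrier R"
  shows "hom_comp (r \<odot>\<^bsub>A\<^esub> x) g = r \<odot>\<^bsub>A\<^esub> hom_comp x g"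
proof -
  let ?F = "hom_supp x"
  have F: "finite ?F" "?F \<subseteq> carrier G"
    using assms finite_hom_supp hom_supp_subset by auto
  have "r \<odot>\<^bsub>A\<^esub> x = r \<odot>\<^bsub>A\<^esub> (\<Oplus>\<^bsub>A\<^esub>g\<in>?F. hom_comp x g)"
    using sum_hom_comp F assms by simp
  also have "\<dots> = (\<Oplus>\<^bsub>A\<^esub>g\<in>?F. r \<odot>\<^bsub>A\<^esub> hom_comp x g)"
    using module.finsum_smult_ldistr[OF is_module F(1) assms(2)] assms by auto
  finally have eq: "r \<odot>\<^bsub>A\<^esub> x = (\<Oplus>\<^bsub>A\<^esub>g\<in>?F. r \<odot>\<^bsub>A\<^esub> hom_comp x g)" .
  have "hom_comp (r \<odot>\<^bsub>A\<^esub> x) = (\<lambda>g. if g \<in> ?F then r \<odot>\<^bsub>A\<^esub> hom_comp x g else \<zero>\<^bsub>A\<^esub>)"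
    unfolding eq by (rule hom_comp_sum[OF F]) (use assms F in \<open>auto intro!: component_smult hom_comp_mem\<close>)
  then show ?thesis using assms by (auto simp: hom_supp_eq)
qed

lemma hom_comp_finsum:
  assumes "f \<in> I \<rightarrow> carrier A"
  shows "hom_comp (\<Oplus>\<^bsub>A\<^esub>i\<in>I. f i) g = (\<Oplus>\<^bsub>A\<^esub>i\<in>I. hom_comp (f i) g)"
  by (rule finsum_additive[OF A.abelian_monoid_axioms A.abelian_monoid_axioms, of "\<lambda>x. hom_comp x g"])
    (use assms in \<open>auto simp: hom_comp_add\<close>)

text \<open>Reduces each identity about projections to a comparison in every degree.\<close>

lemma hom_comp_ext:
  assumes "x \<in> carrier A" "y \<in> carrier A" "\<And>g. hom_comp x g = hom_comp y g"
  shows "x = y"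
proof -
  have "hom_comp x = hom_comp y" using assms(3) by blast
  then show ?thesis
    using assms sum_hom_comp[OF assms(1) finite_hom_supp] sum_hom_comp[OF assms(2) finite_hom_supp]
    by (metis hom_supp_eq order_refl)
qed

text \<open>If \<open>a\<close> also lay in another component, its part in degree \<open>g\<close>
  would be both \<open>a\<close> and zero.\<close>

lemma hdeg_eq:
  assumes "g \<in> carrier G" "a \<in> \<A> g" "a \<noteq> \<zero>\<^bsub>A\<^esub>" shows "hdeg G \<A> a = g"
  unfolding hdeg_def
proof (rule the_equality)
  fix h assume "h \<in> carrier G \<and> a \<in> \<A> h"
  then show "h = g"
    using hom_comp_homogeneous[of g a] hom_comp_homogeneous[of h a] assms by metis
qed (use assms in simp)

text \<open>An element of \<open>A_U\<close> is by definition a finite sum of homogeneous ones, so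
  this is induction on the number of summands. The additive case provides membership in
  \<open>carrier A\<close>, as the distributive laws require. Taking \<open>U\<close> to be the
  whole group gives induction over \<open>A\<close>.\<close>

lemma homogeneous_induct [consumes 2, case_names zero homogeneous add]:
  assumes "x \<in> restricted_carrier A \<A> U" and U: "U \<subseteq> carrier G" and "P \<zero>\<^bsub>A\<^esub>"
    and hom: "\<And>u a. \<lbrakk>u \<in> U; a \<in> \<A> u\<rbrakk> \<Longrightarrow> P a"
    and add: "\<And>x y. \<lbrakk>x \<in> carrier A; y \<in> carrier A; P x; P y\<rbrakk> \<Longrightarrow> P (x \<oplus>\<^bsub>A\<^esub> y)"
  shows "P x"
proof -
  obtain F f where F: "finite F" "F \<subseteq> U" "\<forall>u\<in>F. f u \<in> \<A> u" "x = (\<Oplus>\<^bsub>A\<^esub>u\<in>F. f u)"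
    using assms(1) unfolding restricted_carrier_def by blast
  have "P (\<Oplus>\<^bsub>A\<^esub>u\<in>F. f u)"
    using F(1-3)
  proof (induction F)
    case (insert u F)
    have cl: "f \<in> F \<rightarrow> carrier A" "f u \<in> carrier A"
      using insert.prems component_closed U by auto
    then have "P (f u \<oplus>\<^bsub>A\<^esub> (\<Oplus>\<^bsub>A\<^esub>u\<in>F. f u))"
      using insert by (intro add A.finsum_closed) (auto intro: hom)
    then show ?case using insert.hyps cl by simp
  qed (use assms(3) in simp)
  then show ?thesis using F by simp
qed

text \<open>Replaces the existence of a finite representation by the vanishing of components, so
  that closure of \<open>A_U\<close> under the operations becomes a computation in each
  degree.\<close>

lemma restricted_carrier_iff:
  assumes U: "U \<subseteq> carrier G"
  shows "x \<in> restricted_carrier A \<A> U \<longleftrightarrow>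
    x \<in> carrier A \<and> (\<forall>g. g \<notin> U \<longrightarrow> hom_comp x g = \<zero>\<^bsub>A\<^esub>)" (is "_ \<longleftrightarrow> ?r")
proof
  assume "x \<in> restricted_carrier A \<A> U"
  then obtain F f where F: "finite F" "F \<subseteq> U" "\<forall>u\<in>F. f u \<in> \<A> u" "x = (\<Oplus>\<^bsub>A\<^esub>u\<in>F. f u)"
    unfolding restricted_carrier_def by blast
  then have "x \<in> carrier A" 
    using component_closed U by (auto intro!: A.finsum_closed)
  moreover have "hom_comp x = (\<lambda>g. if g \<in> F then f g else \<zero>\<^bsub>A\<^esub>)"
    using hom_comp_sum[of F f] F U by auto
  ultimately show ?r using F by auto
next
  assume r: ?r
  then have "x = (\<Oplus>\<^bsub>A\<^esub>u\<in>hom_supp x. hom_comp x u)" "hom_supp x \<subseteq> U"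
    using sum_hom_comp[OF _ finite_hom_supp] by (auto simp: hom_supp_eq)
  then show "x \<in> restricted_carrier A \<A> U"
    unfolding restricted_carrier_def using r U hom_comp_mem finite_hom_supp by blast
qed

text \<open>Intersecting with the support keeps the sum finite even for infinite
  \<open>U\<close>.\<close>

definition proj :: "'g set \<Rightarrow> 'a \<Rightarrow> 'a"
  where "proj U x = (\<Oplus>\<^bsub>A\<^esub>g\<in>hom_supp x \<inter> U. hom_comp x g)"

lemma proj_closed [simp]: "x \<in> carrier A \<Longrightarrow> proj U x \<in> carrier A"
  unfolding proj_def by (auto intro!: A.finsum_closed)

lemma hom_comp_proj:
  assumes "x \<in> carrier A"
  shows "hom_comp (proj U x) g = (if g \<in> U then hom_comp x g else \<zero>\<^bsub>A\<^esub>)"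
proof -
  have "hom_comp (proj U x) = (\<lambda>g. if g \<in> hom_supp x \<inter> U then hom_comp x g else \<zero>\<^bsub>A\<^esub>)"
    unfolding proj_def
    by (rule hom_comp_sum)
      (use assms finite_hom_supp hom_supp_subset in \<open>auto intro!: hom_comp_mem\<close>)
  then show ?thesis using assms by (simp add: hom_supp_eq)
qed

lemma proj_mem: "\<lbrakk>U \<subseteq> carrier G; x \<in> carrier A\<rbrakk> \<Longrightarrow> proj U x \<in> restricted_carrier A \<A> U"
  by (simp add: restricted_carrier_iff hom_comp_proj)

lemma proj_id:
  assumes "U \<subseteq> carrier G" "x \<in> restricted_carrier A \<A> U" shows "proj U x = x"
  by (rule hom_comp_ext) (use assms in \<open>auto simp: restricted_carrier_iff hom_comp_proj\<close>)

lemma proj_add: "\<lbrakk>x \<in> carrier A; y \<in> carrier A\<rbrakk> \<Longrightarrow> proj U (x \<oplus>\<^bsub>A\<^esub> y) = proj U x \<oplus>\<^bsub>A\<^esub> proj U y"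
  by (rule hom_comp_ext) (auto simp: hom_comp_proj hom_comp_add)

lemma proj_smult: "\<lbrakk>r \<in> carrier R; x \<in> carrier A\<rbrakk> \<Longrightarrow> proj U (r \<odot>\<^bsub>A\<^esub> x) = r \<odot>\<^bsub>A\<^esub> proj U x"
  by (rule hom_comp_ext) (auto simp: hom_comp_proj hom_comp_smult)

lemma proj_zero [simp]: "proj U \<zero>\<^bsub>A\<^esub> = \<zero>\<^bsub>A\<^esub>"
  by (rule hom_comp_ext) (auto simp: hom_comp_proj)

lemma proj_finsum:
  "f \<in> I \<rightarrow> carrier A \<Longrightarrow> proj U (\<Oplus>\<^bsub>A\<^esub>i\<in>I. f i) = (\<Oplus>\<^bsub>A\<^esub>i\<in>I. proj U (f i))"
  by (rule finsum_additive[OF A.abelian_monoid_axioms A.abelian_monoid_axioms])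
    (auto simp: proj_add)

lemma proj_homogeneous:
  assumes "g \<in> carrier G" "a \<in> \<A> g" shows "proj U a = (if g \<in> U then a else \<zero>\<^bsub>A\<^esub>)"
  by (rule hom_comp_ext)
    (use assms component_closed in \<open>auto simp: hom_comp_proj hom_comp_homogeneous\<close>)

text \<open>The factors must be nonzero for \<open>hdeg\<close> to be determined. Their product may
  well vanish: \<open>proj_homogeneous\<close> asks only that it lie in the component of
  \<open>g\<close> times \<open>h\<close>.\<close>

lemma homogeneous_restricted_mult_eq:
  assumes "g \<in> carrier G" "h \<in> carrier G" "a \<in> \<A> g" "b \<in> \<A> h" "a \<noteq> \<zero>\<^bsub>A\<^esub>" "b \<noteq> \<zero>\<^bsub>A\<^esub>"
  shows "homogeneous_restricted_mult G A \<A> U a b = proj U (a \<otimes>\<^bsub>A\<^esub> b)"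
  unfolding homogeneous_restricted_mult_def
  using assms proj_homogeneous[of "g \<otimes>\<^bsub>G\<^esub> h" "a \<otimes>\<^bsub>A\<^esub> b" U] component_mult
  by (simp add: hdeg_eq)

text \<open>Additivity moves the projection outside both sums; what remains inside is the
  distributive expansion of \<open>x\<close> times \<open>y\<close>.\<close>

lemma restricted_mult_eq_proj:
  assumes x: "x \<in> carrier A" and y: "y \<in> carrier A"
  shows "restricted_mult G A \<A> U x y = proj U (x \<otimes>\<^bsub>A\<^esub> y)"
proof -
  have "restricted_mult G A \<A> U x y =
      (\<Oplus>\<^bsub>A\<^esub>g\<in>hom_supp x. \<Oplus>\<^bsub>A\<^esub>h\<in>hom_supp y. proj U (hom_comp x g \<otimes>\<^bsub>A\<^esub> hom_comp y h))"
    unfolding restricted_mult_def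
  proof (intro A.finsum_cong' refl funcsetI A.finsum_closed)
    \<comment> \<open>Indices in the supports have nonzero components, so their degrees are
      \<open>g\<close> and \<open>h\<close>.\<close>
    fix g h assume gh: "g \<in> hom_supp x" "h \<in> hom_supp y"
    then have "g \<in> carrier G" "h \<in> carrier G" using hom_supp_subset by auto
    then show "homogeneous_restricted_mult G A \<A> U (hom_comp x g) (hom_comp y h) =
        proj U (hom_comp x g \<otimes>\<^bsub>A\<^esub> hom_comp y h)"
      using gh x y
      by (intro homogeneous_restricted_mult_eq[of g h]) (auto simp: hom_supp_eq hom_comp_mem)
  qed (use x y in auto)
  also have "\<dots> = (\<Oplus>\<^bsub>A\<^esub>g\<in>hom_supp x. proj U (\<Oplus>\<^bsub>A\<^esub>h\<in>hom_supp y. hom_comp x g \<otimes>\<^bsub>A\<^esub> hom_comp y h))"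
    using x y by (intro A.finsum_cong' refl proj_finsum[symmetric]) (auto intro!: A.finsum_closed)
  also have "\<dots> = proj U (\<Oplus>\<^bsub>A\<^esub>g\<in>hom_supp x. \<Oplus>\<^bsub>A\<^esub>h\<in>hom_supp y. hom_comp x g \<otimes>\<^bsub>A\<^esub> hom_comp y h)"
    using x y by (intro proj_finsum[symmetric]) (auto intro!: A.finsum_closed)
  also have "(\<Oplus>\<^bsub>A\<^esub>g\<in>hom_supp x. \<Oplus>\<^bsub>A\<^esub>h\<in>hom_supp y. hom_comp x g \<otimes>\<^bsub>A\<^esub> hom_comp y h) =
      (\<Oplus>\<^bsub>A\<^esub>g\<in>hom_supp x. hom_comp x g \<otimes>\<^bsub>A\<^esub> y)"
  proof (intro A.finsum_cong' refl)
    fix g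
    have "hom_comp x g \<otimes>\<^bsub>A\<^esub> y = hom_comp x g \<otimes>\<^bsub>A\<^esub> (\<Oplus>\<^bsub>A\<^esub>h\<in>hom_supp y. hom_comp y h)"
      using sum_hom_comp[OF y finite_hom_supp] y by simp
    then show "(\<Oplus>\<^bsub>A\<^esub>h\<in>hom_supp y. hom_comp x g \<otimes>\<^bsub>A\<^esub> hom_comp y h) = hom_comp x g \<otimes>\<^bsub>A\<^esub> y"
      using A.finsum_rdistr[OF finite_hom_supp[OF y]] x y by simp
  qed (use x y in auto)
  also have "\<dots> = (\<Oplus>\<^bsub>A\<^esub>g\<in>hom_supp x. hom_comp x g) \<otimes>\<^bsub>A\<^esub> y"
    using x y by (intro A.finsum_ldistr[symmetric] finite_hom_supp) auto
  also have "(\<Oplus>\<^bsub>A\<^esub>g\<in>hom_supp x. hom_comp x g) = x"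
    using sum_hom_comp[OF x finite_hom_supp] x by simp
  finally show ?thesis .
qed

text \<open>The component of the unit in degree one is itself a right unit, by comparing degrees.\<close>

lemma one_homogeneous: "\<one>\<^bsub>A\<^esub> \<in> \<A> \<one>\<^bsub>G\<^esub>"
proof -
  let ?e = "hom_comp \<one>\<^bsub>A\<^esub> \<one>\<^bsub>G\<^esub>"
  have e: "?e \<in> carrier A" by simp
  have hom: "a \<otimes>\<^bsub>A\<^esub> ?e = a" if h: "h \<in> carrier G" "a \<in> \<A> h" for h a
  proof -
    \<comment> \<open>The neutral element is inserted so that \<open>?e\<close> occurs as a term of
      the sum; that it is nonzero is not known at this point.\<close>
    let ?F = "insert \<one>\<^bsub>G\<^esub> (hom_supp \<one>\<^bsub>A\<^esub>)"
    have a: "a \<in> carrier A" using component_closed h by simp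
    have F: "finite ?F" "?F \<subseteq> carrier G" using finite_hom_supp hom_supp_subset by auto
    have "a = a \<otimes>\<^bsub>A\<^esub> (\<Oplus>\<^bsub>A\<^esub>g\<in>?F. hom_comp \<one>\<^bsub>A\<^esub> g)"
      using a by (simp only: sum_hom_comp[OF A.one_closed F(1)] subset_insertI A.r_one)
    also have "\<dots> = (\<Oplus>\<^bsub>A\<^esub>g\<in>?F. a \<otimes>\<^bsub>A\<^esub> hom_comp \<one>\<^bsub>A\<^esub> g)"
      by (rule A.finsum_rdistr[OF F(1) a]) auto
    finally have eq: "a = (\<Oplus>\<^bsub>A\<^esub>g\<in>?F. a \<otimes>\<^bsub>A\<^esub> hom_comp \<one>\<^bsub>A\<^esub> g)" .
    have "a = hom_comp a h"
      using hom_comp_homogeneous[OF h] by simp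
    also have "\<dots> = hom_comp (\<Oplus>\<^bsub>A\<^esub>g\<in>?F. a \<otimes>\<^bsub>A\<^esub> hom_comp \<one>\<^bsub>A\<^esub> g) h"
      using arg_cong[OF eq, of "\<lambda>x. hom_comp x h"] .
    also have "\<dots> = (\<Oplus>\<^bsub>A\<^esub>g\<in>?F. hom_comp (a \<otimes>\<^bsub>A\<^esub> hom_comp \<one>\<^bsub>A\<^esub> g) h)"
      by (rule hom_comp_finsum) (use a in auto)
    \<comment> \<open>The product of \<open>a\<close> with the part of degree \<open>g\<close> has
      degree \<open>h\<close> times \<open>g\<close>, and by cancellation this is \<open>h\<close>
      only for neutral \<open>g\<close>.\<close>
    also have "\<dots> = (\<Oplus>\<^bsub>A\<^esub>g\<in>?F. if g = \<one>\<^bsub>G\<^esub> then a \<otimes>\<^bsub>A\<^esub> hom_comp \<one>\<^bsub>A\<^esub> g else \<zero>\<^bsub>A\<^esub>)"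
    proof (intro A.finsum_cong' refl)
      fix g assume "g \<in> ?F"
      then have g: "g \<in> carrier G" using F by auto
      then have "a \<otimes>\<^bsub>A\<^esub> hom_comp \<one>\<^bsub>A\<^esub> g \<in> \<A> (h \<otimes>\<^bsub>G\<^esub> g)"
        using h hom_comp_mem component_mult by simp
      then show "hom_comp (a \<otimes>\<^bsub>A\<^esub> hom_comp \<one>\<^bsub>A\<^esub> g) h =
          (if g = \<one>\<^bsub>G\<^esub> then a \<otimes>\<^bsub>A\<^esub> hom_comp \<one>\<^bsub>A\<^esub> g else \<zero>\<^bsub>A\<^esub>)"
        using g h hom_comp_homogeneous[of "h \<otimes>\<^bsub>G\<^esub> g"] G.l_cancel_one'[of h g] by auto
    qed (use a in auto)
    also have "\<dots> = a \<otimes>\<^bsub>A\<^esub> ?e"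
      using A.add.finprod_singleton_swap[of "\<one>\<^bsub>G\<^esub>" ?F "\<lambda>g. a \<otimes>\<^bsub>A\<^esub> hom_comp \<one>\<^bsub>A\<^esub> g"] F a by auto
    finally show ?thesis by simp
  qed
  have "x \<otimes>\<^bsub>A\<^esub> ?e = x" if "x \<in> restricted_carrier A \<A> (carrier G)" for x
    using that subset_refl
  proof (induction x rule: homogeneous_induct)
    case (homogeneous u a)
    then show ?case using hom by simp
  qed (use e in \<open>auto simp: A.l_distr\<close>)
  \<comment> \<open>The left side is also \<open>?e\<close>, since the unit of \<open>A\<close> acts
    trivially from the left. So the unit equals its component of neutral degree.\<close>
  then have "\<one>\<^bsub>A\<^esub> \<otimes>\<^bsub>A\<^esub> ?e = \<one>\<^bsub>A\<^esub>"
    using restricted_carrier_iff hom_comp_outside by auto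
  then show ?thesis
    using hom_comp_mem[of "\<one>\<^bsub>A\<^esub>" "\<one>\<^bsub>G\<^esub>"] by simp
qed

text \<open>Both sides are additive in each argument, so three nested inductions reduce the identity
  to homogeneous \<open>a\<close>, \<open>b\<close>, \<open>c\<close> of degrees \<open>u\<close>,
  \<open>v\<close>, \<open>w\<close>.\<close>

lemma proj_assoc:
  assumes "ring_supporting G U" and U: "U \<subseteq> carrier G"
    and x: "x \<in> restricted_carrier A \<A> U" and y: "y \<in> restricted_carrier A \<A> U"
    and z: "z \<in> restricted_carrier A \<A> U"
  shows "proj U (proj U (x \<otimes>\<^bsub>A\<^esub> y) \<otimes>\<^bsub>A\<^esub> z) = proj U (x \<otimes>\<^bsub>A\<^esub> proj U (y \<otimes>\<^bsub>A\<^esub> z))"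
proof -
  have cl: "y \<in> carrier A" "z \<in> carrier A"
    using y z restricted_carrier_iff[OF U] by auto
  show ?thesis
    using x U
  proof (induction x rule: homogeneous_induct)
    case a: (homogeneous u a)
    have a': "a \<in> carrier A" using a U component_closed by auto
    show ?case
      using y U
    proof (induction y rule: homogeneous_induct)
      case b: (homogeneous v b)
      have b': "b \<in> carrier A" using b U component_closed by auto
      show ?case
        using z U
      proof (induction z rule: homogeneous_induct)
        case c: (homogeneous w c)
        have c': "c \<in> carrier A" using c U component_closed by auto
        have G: "u \<in> carrier G" "v \<in> carrier G" "w \<in> carrier G" using a b c U by auto
        have ab: "proj U (a \<otimes>\<^bsub>A\<^esub> b) = (if u \<otimes>\<^bsub>G\<^esub> v \<in> U then a \<otimes>\<^bsub>A\<^esub> b else \<zero>\<^bsub>A\<^esub>)"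
          and bc: "proj U (b \<otimes>\<^bsub>A\<^esub> c) = (if v \<otimes>\<^bsub>G\<^esub> w \<in> U then b \<otimes>\<^bsub>A\<^esub> c else \<zero>\<^bsub>A\<^esub>)"
          using G a b c by (intro proj_homogeneous component_mult; simp)+
        \<comment> \<open>If uvw lies outside \<open>U\<close>, the outer projection kills both
          sides, whatever the inner ones do. Hence the condition on uv and vw is only required when
          uvw is in \<open>U\<close>.\<close>
        have "a \<otimes>\<^bsub>A\<^esub> b \<otimes>\<^bsub>A\<^esub> c \<in> \<A> (u \<otimes>\<^bsub>G\<^esub> v \<otimes>\<^bsub>G\<^esub> w)"
          using G a b c by (auto intro!: component_mult)
        then have "proj U (a \<otimes>\<^bsub>A\<^esub> b \<otimes>\<^bsub>A\<^esub> c) =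
            (if u \<otimes>\<^bsub>G\<^esub> v \<otimes>\<^bsub>G\<^esub> w \<in> U then a \<otimes>\<^bsub>A\<^esub> b \<otimes>\<^bsub>A\<^esub> c else \<zero>\<^bsub>A\<^esub>)"
          using G by (intro proj_homogeneous) auto
        moreover have "u \<otimes>\<^bsub>G\<^esub> v \<otimes>\<^bsub>G\<^esub> w \<in> U \<Longrightarrow> u \<otimes>\<^bsub>G\<^esub> v \<in> U \<longleftrightarrow> v \<otimes>\<^bsub>G\<^esub> w \<in> U"
          using ring_supportingD[OF assms(1) a(1) b(1) c(1)] .
        ultimately show ?case
          using a' b' c' by (auto simp: ab bc A.m_assoc)
      qed (use a' b' in \<open>auto simp: A.r_distr proj_add\<close>)
    qed (use a' cl in \<open>auto simp: A.r_distr A.l_distr proj_add\<close>)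
  qed (use cl in \<open>auto simp: A.l_distr proj_add\<close>)
qed

end

section \<open>The support-restricted algebra\<close>

lemma gradingI:
  assumes "graded_algebra G R A \<A>" shows "grading G R A \<A>"
proof -
  interpret graded_algebra G R A \<A> by fact
  show ?thesis
    by (intro grading.intro grading_axioms.intro assms) (rule group_axioms R.cring_axioms ring_axioms)+
qed

lemma support_restriction_simps [simp]:
  "carrier (support_restriction G A \<A> U e) = restricted_carrier A \<A> U"
  "monoid.mult (support_restriction G A \<A> U e) = restricted_mult G A \<A> U"
  "one (support_restriction G A \<A> U e) = e"
  "ring.zero (support_restriction G A \<A> U e) = \<zero>\<^bsub>A\<^esub>"
  "add (support_restriction G A \<A> U e) = add A"
  "smult (support_restriction G A \<A> U e) = smult A"
  by (simp_all add: support_restriction_def)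

text \<open>The unit of \<open>A\<close> has neutral degree, hence lies in \<open>A_U\<close>; it
  remains a unit because the projection fixes \<open>A_U\<close>.\<close>

theorem graded_support_restriction:
  fixes G :: "('g, 'm) monoid_scheme" and A :: "('r, 'a) module"
  assumes "graded_algebra G R A \<A>" and rs: "ring_supporting G U" and U: "U \<subseteq> carrier G"
  shows "graded_algebra G R (support_restriction G A \<A> U \<one>\<^bsub>A\<^esub>) (restricted_grading A \<A> U)"
proof -
  interpret grading G R A \<A> using assms(1) by (rule gradingI)
  interpret M: module R A by (rule is_module)
  let ?C = "restricted_carrier A \<A> U" and ?B = "support_restriction G A \<A> U \<one>\<^bsub>A\<^esub>"
    and ?\<B> = "restricted_grading A \<A> U"
  note C = restricted_carrier_iff[OF U]
  have CA: "x \<in> carrier A" if "x \<in> ?C" for x using that C by simp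
  have add_C: "x \<oplus>\<^bsub>A\<^esub> y \<in> ?C" if "x \<in> ?C" "y \<in> ?C" for x y
    using that by (simp add: C hom_comp_add)
  have zero_C: "\<zero>\<^bsub>A\<^esub> \<in> ?C" by (simp add: C)
  have smult_C: "r \<odot>\<^bsub>A\<^esub> x \<in> ?C" if "r \<in> carrier R" "x \<in> ?C" for r x
    using that by (simp add: C hom_comp_smult)
  have hom_C: "a \<in> ?C" if "u \<in> U" "a \<in> \<A> u" for u a
    using that U component_closed hom_comp_homogeneous[of u a] by (auto simp: C)
  have one_U: "\<one>\<^bsub>G\<^esub> \<in> U" using rs by (simp add: ring_supporting_def)
  have mult: "restricted_mult G A \<A> U x y = proj U (x \<otimes>\<^bsub>A\<^esub> y)" if "x \<in> ?C" "y \<in> ?C" for x y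
    using that by (simp add: restricted_mult_eq_proj C)
  have mult_C: "proj U (x \<otimes>\<^bsub>A\<^esub> y) \<in> ?C" if "x \<in> ?C" "y \<in> ?C" for x y
    using that U by (simp add: proj_mem CA)
  have ab: "abelian_group ?B"
  proof (rule abelian_groupI)
    fix x assume x: "x \<in> carrier ?B"
    then have "(\<ominus>\<^bsub>R\<^esub> \<one>\<^bsub>R\<^esub>) \<odot>\<^bsub>A\<^esub> x \<oplus>\<^bsub>A\<^esub> x = \<zero>\<^bsub>A\<^esub>"
      using CA by (simp add: M.smult_l_minus A.l_neg)
    moreover have "(\<ominus>\<^bsub>R\<^esub> \<one>\<^bsub>R\<^esub>) \<odot>\<^bsub>A\<^esub> x \<in> ?C" using x by (simp add: smult_C)
    ultimately show "\<exists>y\<in>carrier ?B. y \<oplus>\<^bsub>?B\<^esub> x = \<zero>\<^bsub>?B\<^esub>" by auto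
  qed (auto simp: add_C zero_C CA A.a_assoc intro: A.a_comm)
  have mod: "module R ?B"
    using ab by (intro moduleI R.is_cring)
      (auto simp: smult_C CA M.smult_l_distr M.smult_r_distr M.smult_assoc1)
  have rg: "ring ?B"
  proof (intro ringI ab monoidI)
    fix x y z assume xyz: "x \<in> carrier ?B" "y \<in> carrier ?B" "z \<in> carrier ?B"
    then show "x \<otimes>\<^bsub>?B\<^esub> y \<otimes>\<^bsub>?B\<^esub> z = x \<otimes>\<^bsub>?B\<^esub> (y \<otimes>\<^bsub>?B\<^esub> z)"
      using proj_assoc[OF rs U] by (simp add: mult mult_C)
    show "(x \<oplus>\<^bsub>?B\<^esub> y) \<otimes>\<^bsub>?B\<^esub> z = x \<otimes>\<^bsub>?B\<^esub> z \<oplus>\<^bsub>?B\<^esub> y \<otimes>\<^bsub>?B\<^esub> z"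
      using xyz by (simp add: mult add_C CA A.l_distr proj_add)
    show "z \<otimes>\<^bsub>?B\<^esub> (x \<oplus>\<^bsub>?B\<^esub> y) = z \<otimes>\<^bsub>?B\<^esub> x \<oplus>\<^bsub>?B\<^esub> z \<otimes>\<^bsub>?B\<^esub> y"
      using xyz by (simp add: mult add_C CA A.r_distr proj_add)
  qed (use hom_C[OF one_U one_homogeneous] in \<open>auto simp: mult mult_C CA proj_id[OF U]\<close>)
  have ua: "unital_algebra R ?B"
    using one_neq_zero
    by (intro unital_algebra.intro mod rg unital_algebra_axioms.intro)
      (auto simp: mult smult_C CA smult_mult_left smult_mult_right proj_smult)
  interpret B: abelian_group ?B by (rule ab)
  have sub: "?\<B> g \<subseteq> \<A> g \<inter> ?C" if "g \<in> carrier G" for g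
    using that hom_C zero_C component_zero by (auto simp: restricted_grading_def)
  \<comment> \<open>\<open>finsum\<close> depends on the record, so sums in \<open>?B\<close> and in
    \<open>A\<close> are different terms; the inclusion of \<open>A_U\<close> into \<open>A\<close>
    is additive and identifies them.\<close>
  have sum: "(\<Oplus>\<^bsub>?B\<^esub>i\<in>I. f i) = (\<Oplus>\<^bsub>A\<^esub>i\<in>I. f i)" if "f \<in> I \<rightarrow> ?C" for I :: "'g set" and f
    by (rule finsum_additive[OF B.abelian_monoid_axioms A.abelian_monoid_axioms, of "\<lambda>x. x"])
      (use that CA in auto)
  \<comment> \<open>The equivalence provides existence and uniqueness of decompositions in
    \<open>?B\<close> together, by comparison with those in \<open>A\<close>.\<close>
  have dec: "homogeneous_decomposition G ?B ?\<B> x f \<longleftrightarrow> f = hom_comp x" if x: "x \<in> ?C" for x f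
  proof
    assume f: "homogeneous_decomposition G ?B ?\<B> x f"
    then have "f g \<in> \<A> g \<inter> ?C" if "g \<in> carrier G" for g
      using that sub unfolding homogeneous_decomposition_def by blast
    moreover have "f g = \<zero>\<^bsub>A\<^esub>" if "g \<notin> carrier G" for g
      using that f unfolding homogeneous_decomposition_def by auto
    ultimately have "homogeneous_decomposition G A \<A> x f"
      using f sum[of f "{g. f g \<noteq> \<zero>\<^bsub>A\<^esub>}"] unfolding homogeneous_decomposition_def by auto
    then show "f = hom_comp x" using hom_comp_eqI CA[OF x] by blast
  next
    assume f: "f = hom_comp x"
    have "f g \<in> ?\<B> g" if "g \<in> carrier G" for g
      using x that hom_comp_mem[of x g] by (auto simp: f restricted_grading_def C)
    moreover have "f g \<in> ?C" for g
      using calculation[of g] sub[of g] zero_C hom_comp_outside[of x g] CA[OF x] f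
      by (cases "g \<in> carrier G") auto
    ultimately show "homogeneous_decomposition G ?B ?\<B> x f"
      using decomposition_hom_comp[OF CA[OF x]] f sum[of f "{g. f g \<noteq> \<zero>\<^bsub>A\<^esub>}"]
      unfolding homogeneous_decomposition_def by auto
  qed
  show ?thesis
  proof (intro graded_algebra.intro G.is_group ua graded_algebra_axioms.intro)
    fix g assume g: "g \<in> carrier G"
    show "submodule (?\<B> g) R ?B"
      by (rule module.submoduleI'[OF mod])
        (use g sub in \<open>auto simp: restricted_grading_def component_zero component_add component_smult\<close>)
  next
    fix x assume "x \<in> carrier ?B"
    then show "\<exists>!f. homogeneous_decomposition G ?B ?\<B> x f" by (simp add: dec)
  next
    fix g h x y assume gh: "g \<in> carrier G" "h \<in> carrier G" and xy: "x \<in> ?\<B> g" "y \<in> ?\<B> h"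
    \<comment> \<open>If the product of \<open>g\<close> and \<open>h\<close> lies outside
      \<open>U\<close>, the projection yields zero, the only element of that component of
      \<open>?\<B>\<close>.\<close>
    have "x \<in> \<A> g \<inter> ?C" "y \<in> \<A> h \<inter> ?C" using gh xy sub by auto
    then show "x \<otimes>\<^bsub>?B\<^esub> y \<in> ?\<B> (g \<otimes>\<^bsub>G\<^esub> h)"
      using gh component_mult[of g h x y] proj_homogeneous[of "g \<otimes>\<^bsub>G\<^esub> h" "x \<otimes>\<^bsub>A\<^esub> y" U]
      by (simp add: mult restricted_grading_def)
  qed
qed

section \<open>The group algebra\<close>

definition supp :: "('r, 'n) ring_scheme \<Rightarrow> ('g \<Rightarrow> 'r) \<Rightarrow> 'g set"
  where "supp R f = {g. f g \<noteq> \<zero>\<^bsub>R\<^esub>}"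

text \<open>R[G] as finitely supported functions under convolution. Functions live on the whole type
  \<open>'g\<close>, so they are required to vanish off \<open>carrier G\<close>; the conditional in
  the product enforces this where \<open>inv\<close> and the group product carry no
  information.\<close>

definition group_algebra ::
    "('g, 'm) monoid_scheme \<Rightarrow> ('r, 'n) ring_scheme \<Rightarrow> ('r, 'g \<Rightarrow> 'r) module"
  where "group_algebra G R =
    \<lparr>carrier = {f. range f \<subseteq> carrier R \<and> finite (supp R f) \<and> supp R f \<subseteq> carrier G},
     monoid.mult = (\<lambda>f f' k. if k \<in> carrier G
       then \<Oplus>\<^bsub>R\<^esub>h\<in>supp R f. f h \<otimes>\<^bsub>R\<^esub> f' (inv\<^bsub>G\<^esub> h \<otimes>\<^bsub>G\<^esub> k) else \<zero>\<^bsub>R\<^esub>),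
     one = (\<lambda>k. if k = \<one>\<^bsub>G\<^esub> then \<one>\<^bsub>R\<^esub> else \<zero>\<^bsub>R\<^esub>),
     ring.zero = (\<lambda>_. \<zero>\<^bsub>R\<^esub>), add = (\<lambda>f f' k. f k \<oplus>\<^bsub>R\<^esub> f' k),
     smult = (\<lambda>r f k. r \<otimes>\<^bsub>R\<^esub> f k)\<rparr>"

definition group_algebra_grading ::
    "('g, 'm) monoid_scheme \<Rightarrow> ('r, 'n) ring_scheme \<Rightarrow> 'g \<Rightarrow> ('g \<Rightarrow> 'r) set"
  where "group_algebra_grading G R g = {f \<in> carrier (group_algebra G R). supp R f \<subseteq> {g}}"

text \<open>The group element \<open>g\<close> regarded as a basis element of R[G].\<close>

definition delta :: "('r, 'n) ring_scheme \<Rightarrow> 'g \<Rightarrow> 'g \<Rightarrow> 'r"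
  where "delta R g = (\<lambda>k. if k = g then \<one>\<^bsub>R\<^esub> else \<zero>\<^bsub>R\<^esub>)"

locale group_algebra_base = G: group G + R: cring R
  for G :: "('g, 'm) monoid_scheme" and R :: "('r, 'n) ring_scheme"
begin

abbreviation "RG \<equiv> group_algebra G R"
abbreviation "grad \<equiv> group_algebra_grading G R"

lemma group_algebra_simps:
  "one RG = delta R \<one>\<^bsub>G\<^esub>" "ring.zero RG = (\<lambda>_. \<zero>\<^bsub>R\<^esub>)"
  "add RG f f' = (\<lambda>k. f k \<oplus>\<^bsub>R\<^esub> f' k)" "smult RG r f = (\<lambda>k. r \<otimes>\<^bsub>R\<^esub> f k)"
  by (simp_all add: group_algebra_def delta_def)

lemma carrier_iff:
  "f \<in> carrier RG \<longleftrightarrow> (\<forall>g. f g \<in> carrier R) \<and> finite (supp R f) \<and> supp R f \<subseteq> carrier G"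
  by (auto simp: group_algebra_def)

lemma carrierI:
  assumes "\<And>g. f g \<in> carrier R" "finite F" "F \<subseteq> carrier G" "\<And>g. g \<notin> F \<Longrightarrow> f g = \<zero>\<^bsub>R\<^esub>"
  shows "f \<in> carrier RG"
proof -
  have "supp R f \<subseteq> F" using assms(4) by (auto simp: supp_def)
  then show ?thesis using assms finite_subset by (auto simp: carrier_iff)
qed

lemma
  assumes "f \<in> carrier RG"
  shows coeff_closed [simp]: "f g \<in> carrier R"
    and finite_supp: "finite (supp R f)"
    and supp_subset: "supp R f \<subseteq> carrier G"
  using assms by (auto simp: carrier_iff)

lemma supp_zero: "g \<notin> supp R f \<Longrightarrow> f g = \<zero>\<^bsub>R\<^esub>"
  by (simp add: supp_def)

lemma coeff_outside: "\<lbrakk>f \<in> carrier RG; k \<notin> carrier G\<rbrakk> \<Longrightarrow> f k = \<zero>\<^bsub>R\<^esub>"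
  using supp_zero[of k f] supp_subset[of f] by auto

section \<open>The convolution product\<close>

lemma mult_outside: "k \<notin> carrier G \<Longrightarrow> (f \<otimes>\<^bsub>RG\<^esub> f') k = \<zero>\<^bsub>R\<^esub>"
  by (simp add: group_algebra_def)

text \<open>Any finite superset of the support may serve as index set, since the additional terms
  vanish; this allows several convolutions to be compared term by term.\<close>

lemma mult_eq:
  assumes "f \<in> carrier RG" "f' \<in> carrier RG" "finite F" "supp R f \<subseteq> F" "k \<in> carrier G"
  shows "(f \<otimes>\<^bsub>RG\<^esub> f') k = (\<Oplus>\<^bsub>R\<^esub>h\<in>F. f h \<otimes>\<^bsub>R\<^esub> f' (inv\<^bsub>G\<^esub> h \<otimes>\<^bsub>G\<^esub> k))"
proof -
  have "(f \<otimes>\<^bsub>RG\<^esub> f') k = (\<Oplus>\<^bsub>R\<^esub>h\<in>supp R f. f h \<otimes>\<^bsub>R\<^esub> f' (inv\<^bsub>G\<^esub> h \<otimes>\<^bsub>G\<^esub> k))"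
    using assms(5) by (simp add: group_algebra_def)
  also have "\<dots> = (\<Oplus>\<^bsub>R\<^esub>h\<in>F. f h \<otimes>\<^bsub>R\<^esub> f' (inv\<^bsub>G\<^esub> h \<otimes>\<^bsub>G\<^esub> k))"
    by (rule R.finsum_mono_neutral_left) (use assms in \<open>auto simp: supp_zero\<close>)
  finally show ?thesis .
qed

text \<open>A nonzero term at \<open>h\<close> places \<open>h\<close> in \<open>F\<close> and its
  complementary factor in \<open>F'\<close>, and \<open>k\<close> is their product. The whole
  supports as \<open>F\<close> and \<open>F'\<close> give finiteness of the support of a product;
  singletons give the grading.\<close>

lemma mult_zero_outside:
  assumes f: "f \<in> carrier RG" "supp R f \<subseteq> F" and f': "f' \<in> carrier RG" "supp R f' \<subseteq> F'"
    and k: "k \<notin> (\<lambda>(h, h'). h \<otimes>\<^bsub>G\<^esub> h') ` (F \<times> F')"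
  shows "(f \<otimes>\<^bsub>RG\<^esub> f') k = \<zero>\<^bsub>R\<^esub>"
proof (cases "k \<in> carrier G")
  case True
  have "(f \<otimes>\<^bsub>RG\<^esub> f') k = (\<Oplus>\<^bsub>R\<^esub>h\<in>supp R f. f h \<otimes>\<^bsub>R\<^esub> f' (inv\<^bsub>G\<^esub> h \<otimes>\<^bsub>G\<^esub> k))"
    using True by (simp add: group_algebra_def)
  also have "\<dots> = (\<Oplus>\<^bsub>R\<^esub>h\<in>supp R f. \<zero>\<^bsub>R\<^esub>)"
  proof (rule R.finsum_cong')
    fix h assume h: "h \<in> supp R f"
    then have hG: "h \<in> carrier G" using supp_subset f by auto
    have "inv\<^bsub>G\<^esub> h \<otimes>\<^bsub>G\<^esub> k \<notin> supp R f'"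
    proof
      assume "inv\<^bsub>G\<^esub> h \<otimes>\<^bsub>G\<^esub> k \<in> supp R f'"
      then have "(h, inv\<^bsub>G\<^esub> h \<otimes>\<^bsub>G\<^esub> k) \<in> F \<times> F'" using h f(2) f'(2) by auto
      then have "h \<otimes>\<^bsub>G\<^esub> (inv\<^bsub>G\<^esub> h \<otimes>\<^bsub>G\<^esub> k) \<in> (\<lambda>(h, h'). h \<otimes>\<^bsub>G\<^esub> h') ` (F \<times> F')"
        by (metis (no_types, lifting) case_prod_conv imageI)
      then show False using k hG True by (simp add: G.m_assoc[symmetric])
    qed
    then show "f h \<otimes>\<^bsub>R\<^esub> f' (inv\<^bsub>G\<^esub> h \<otimes>\<^bsub>G\<^esub> k) = \<zero>\<^bsub>R\<^esub>"
      using f by (simp add: supp_zero)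
  qed auto
  finally show ?thesis by simp
qed (simp add: mult_outside)

lemma mult_coeff_closed:
  assumes "f \<in> carrier RG" "f' \<in> carrier RG" shows "(f \<otimes>\<^bsub>RG\<^esub> f') k \<in> carrier R"
  using assms by (auto simp: group_algebra_def intro!: R.finsum_closed)

lemma mult_closed:
  assumes "f \<in> carrier RG" "f' \<in> carrier RG" shows "f \<otimes>\<^bsub>RG\<^esub> f' \<in> carrier RG"
proof (rule carrierI)
  show "finite ((\<lambda>(h, h'). h \<otimes>\<^bsub>G\<^esub> h') ` (supp R f \<times> supp R f'))"
    using assms finite_supp by simp
  show "(\<lambda>(h, h'). h \<otimes>\<^bsub>G\<^esub> h') ` (supp R f \<times> supp R f') \<subseteq> carrier G"
    using supp_subset[OF assms(1)] supp_subset[OF assms(2)] by auto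
qed (use mult_coeff_closed[OF assms]
    mult_zero_outside[OF assms(1) subset_refl assms(2) subset_refl] in auto)

text \<open>Both sides are the same double sum after an exchange of summations and the substitution
  \<open>l = h m\<close> in the inner sum.\<close>

lemma mult_assoc:
  assumes f: "f \<in> carrier RG" and g: "g \<in> carrier RG" and e: "e \<in> carrier RG"
  shows "f \<otimes>\<^bsub>RG\<^esub> g \<otimes>\<^bsub>RG\<^esub> e = f \<otimes>\<^bsub>RG\<^esub> (g \<otimes>\<^bsub>RG\<^esub> e)"
proof
  fix k
  show "(f \<otimes>\<^bsub>RG\<^esub> g \<otimes>\<^bsub>RG\<^esub> e) k = (f \<otimes>\<^bsub>RG\<^esub> (g \<otimes>\<^bsub>RG\<^esub> e)) k"
  proof (cases "k \<in> carrier G")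
    case k: True
    let ?F = "supp R f" and ?M = "supp R g"
    \<comment> \<open>One finite set that contains the support of \<open>f\<close> times
      \<open>g\<close> and every translate of \<open>?M\<close> by an element of \<open>?F\<close>.
      Being independent of \<open>h\<close>, it permits the exchange of the sums.\<close>
    let ?L = "(\<lambda>(h, h'). h \<otimes>\<^bsub>G\<^esub> h') ` (?F \<times> ?M)"
    let ?i = "\<lambda>h. inv\<^bsub>G\<^esub> h"
    have fin: "finite ?F" "finite ?M" "finite ?L" using finite_supp f g by auto
    have FG: "h \<in> carrier G" if "h \<in> ?F" for h using that supp_subset f by auto
    have MG: "h \<in> carrier G" if "h \<in> ?M" for h using that supp_subset g by auto
    have LG: "h \<in> carrier G" if "h \<in> ?L" for h using that FG MG by auto
    have fg: "supp R (f \<otimes>\<^bsub>RG\<^esub> g) \<subseteq> ?L"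
      using mult_zero_outside[OF f subset_refl g subset_refl] by (auto simp: supp_def)
    have "(f \<otimes>\<^bsub>RG\<^esub> g \<otimes>\<^bsub>RG\<^esub> e) k = (\<Oplus>\<^bsub>R\<^esub>l\<in>?L. (f \<otimes>\<^bsub>RG\<^esub> g) l \<otimes>\<^bsub>R\<^esub> e (?i l \<otimes>\<^bsub>G\<^esub> k))"
      by (rule mult_eq[OF mult_closed[OF f g] e fin(3) fg k])
    also have "\<dots> = (\<Oplus>\<^bsub>R\<^esub>l\<in>?L. \<Oplus>\<^bsub>R\<^esub>h\<in>?F. f h \<otimes>\<^bsub>R\<^esub> (g (?i h \<otimes>\<^bsub>G\<^esub> l) \<otimes>\<^bsub>R\<^esub> e (?i l \<otimes>\<^bsub>G\<^esub> k)))"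
    proof (rule R.finsum_cong'[OF refl])
      fix l assume l: "l \<in> ?L"
      have "(f \<otimes>\<^bsub>RG\<^esub> g) l \<otimes>\<^bsub>R\<^esub> e (?i l \<otimes>\<^bsub>G\<^esub> k) =
          (\<Oplus>\<^bsub>R\<^esub>h\<in>?F. f h \<otimes>\<^bsub>R\<^esub> g (?i h \<otimes>\<^bsub>G\<^esub> l) \<otimes>\<^bsub>R\<^esub> e (?i l \<otimes>\<^bsub>G\<^esub> k))"
        unfolding mult_eq[OF f g fin(1) subset_refl LG[OF l]]
        by (rule R.finsum_ldistr[OF fin(1)]) (use f g e in auto)
      also have "\<dots> = (\<Oplus>\<^bsub>R\<^esub>h\<in>?F. f h \<otimes>\<^bsub>R\<^esub> (g (?i h \<otimes>\<^bsub>G\<^esub> l) \<otimes>\<^bsub>R\<^esub> e (?i l \<otimes>\<^bsub>G\<^esub> k)))"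
        by (rule R.finsum_cong') (use f g e in \<open>auto simp: R.m_assoc\<close>)
      finally show "(f \<otimes>\<^bsub>RG\<^esub> g) l \<otimes>\<^bsub>R\<^esub> e (?i l \<otimes>\<^bsub>G\<^esub> k) = \<dots>" .
    qed (use f g e in \<open>auto intro!: R.finsum_closed\<close>)
    also have "\<dots> = (\<Oplus>\<^bsub>R\<^esub>h\<in>?F. \<Oplus>\<^bsub>R\<^esub>l\<in>?L. f h \<otimes>\<^bsub>R\<^esub> (g (?i h \<otimes>\<^bsub>G\<^esub> l) \<otimes>\<^bsub>R\<^esub> e (?i l \<otimes>\<^bsub>G\<^esub> k)))"
      by (rule R.finsum_swap) (use f g e in auto)
    also have "\<dots> = (\<Oplus>\<^bsub>R\<^esub>h\<in>?F. f h \<otimes>\<^bsub>R\<^esub> (g \<otimes>\<^bsub>RG\<^esub> e) (?i h \<otimes>\<^bsub>G\<^esub> k))"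
    proof (rule R.finsum_cong'[OF refl])
      fix h assume h: "h \<in> ?F"
      have hG: "h \<in> carrier G" using h FG by simp
      \<comment> \<open>For fixed \<open>h\<close> the coefficient of \<open>g\<close> vanishes off
        the translate of \<open>?M\<close> by \<open>h\<close>, so the sum shrinks to it and can be
        reindexed by \<open>?M\<close>.\<close>
      have "(\<Oplus>\<^bsub>R\<^esub>l\<in>?L. g (?i h \<otimes>\<^bsub>G\<^esub> l) \<otimes>\<^bsub>R\<^esub> e (?i l \<otimes>\<^bsub>G\<^esub> k)) =
          (\<Oplus>\<^bsub>R\<^esub>l\<in>(\<lambda>m. h \<otimes>\<^bsub>G\<^esub> m) ` ?M. g (?i h \<otimes>\<^bsub>G\<^esub> l) \<otimes>\<^bsub>R\<^esub> e (?i l \<otimes>\<^bsub>G\<^esub> k))"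
      proof (rule R.finsum_mono_neutral_left[OF fin(3), symmetric])
        fix l assume l: "l \<in> ?L - (\<lambda>m. h \<otimes>\<^bsub>G\<^esub> m) ` ?M"
        have "l = h \<otimes>\<^bsub>G\<^esub> (?i h \<otimes>\<^bsub>G\<^esub> l)"
          using hG LG l by (simp add: G.m_assoc[symmetric])
        then have "?i h \<otimes>\<^bsub>G\<^esub> l \<notin> ?M" using l by auto
        then show "g (?i h \<otimes>\<^bsub>G\<^esub> l) \<otimes>\<^bsub>R\<^esub> e (?i l \<otimes>\<^bsub>G\<^esub> k) = \<zero>\<^bsub>R\<^esub>"
          using e by (simp add: supp_zero)
      qed (use h g e in auto)
      also have "\<dots> = (\<Oplus>\<^bsub>R\<^esub>m\<in>?M. g (?i h \<otimes>\<^bsub>G\<^esub> (h \<otimes>\<^bsub>G\<^esub> m)) \<otimes>\<^bsub>R\<^esub> e (?i (h \<otimes>\<^bsub>G\<^esub> m) \<otimes>\<^bsub>G\<^esub> k))"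
        by (rule R.finsum_reindex) (use g e hG MG in \<open>auto intro!: inj_onI\<close>)
      also have "\<dots> = (\<Oplus>\<^bsub>R\<^esub>m\<in>?M. g m \<otimes>\<^bsub>R\<^esub> e (?i m \<otimes>\<^bsub>G\<^esub> (?i h \<otimes>\<^bsub>G\<^esub> k)))"
        by (rule R.finsum_cong')
          (use g e hG MG k in \<open>auto simp: G.inv_mult_group G.m_assoc[of "inv\<^bsub>G\<^esub> _"] G.inv_solve_left'
            G.m_assoc[of "inv\<^bsub>G\<^esub> h" h, symmetric]\<close>)
      also have "\<dots> = (g \<otimes>\<^bsub>RG\<^esub> e) (?i h \<otimes>\<^bsub>G\<^esub> k)"
        using hG k by (intro mult_eq[symmetric, OF g e fin(2)]) auto
      finally have "(\<Oplus>\<^bsub>R\<^esub>l\<in>?L. g (?i h \<otimes>\<^bsub>G\<^esub> l) \<otimes>\<^bsub>R\<^esub> e (?i l \<otimes>\<^bsub>G\<^esub> k)) = (g \<otimes>\<^bsub>RG\<^esub> e) (?i h \<otimes>\<^bsub>G\<^esub> k)" .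
      then show "(\<Oplus>\<^bsub>R\<^esub>l\<in>?L. f h \<otimes>\<^bsub>R\<^esub> (g (?i h \<otimes>\<^bsub>G\<^esub> l) \<otimes>\<^bsub>R\<^esub> e (?i l \<otimes>\<^bsub>G\<^esub> k))) =
          f h \<otimes>\<^bsub>R\<^esub> (g \<otimes>\<^bsub>RG\<^esub> e) (?i h \<otimes>\<^bsub>G\<^esub> k)"
        using R.finsum_rdistr[OF fin(3), of "f h" "\<lambda>l. g (?i h \<otimes>\<^bsub>G\<^esub> l) \<otimes>\<^bsub>R\<^esub> e (?i l \<otimes>\<^bsub>G\<^esub> k)"] f g e
        by simp
    qed (use f mult_closed[OF g e] in auto)
    also have "\<dots> = (f \<otimes>\<^bsub>RG\<^esub> (g \<otimes>\<^bsub>RG\<^esub> e)) k"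
      by (rule mult_eq[symmetric, OF f mult_closed[OF g e] fin(1) subset_refl k])
    finally show ?thesis .
  qed (simp add: mult_outside)
qed

lemma delta_closed: "g \<in> carrier G \<Longrightarrow> delta R g \<in> carrier RG"
  by (rule carrierI[of _ "{g}"]) (auto simp: delta_def)

lemma delta_mult:
  assumes "g \<in> carrier G" "f \<in> carrier RG" "k \<in> carrier G"
  shows "(delta R g \<otimes>\<^bsub>RG\<^esub> f) k = f (inv\<^bsub>G\<^esub> g \<otimes>\<^bsub>G\<^esub> k)"
proof -
  \<comment> \<open>Only an inclusion: over the zero ring the support is empty.\<close>
  have "supp R (delta R g) \<subseteq> {g}" by (auto simp: supp_def delta_def split: if_splits)
  then show ?thesis
    using mult_eq[OF delta_closed[OF assms(1)] assms(2), of "{g}" k] assms by (simp add: delta_def)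
qed

lemma delta_mult_delta:
  assumes "g \<in> carrier G" "h \<in> carrier G"
  shows "delta R g \<otimes>\<^bsub>RG\<^esub> delta R h = delta R (g \<otimes>\<^bsub>G\<^esub> h)"
proof
  fix k
  show "(delta R g \<otimes>\<^bsub>RG\<^esub> delta R h) k = delta R (g \<otimes>\<^bsub>G\<^esub> h) k"
  proof (cases "k \<in> carrier G")
    case True
    then have "inv\<^bsub>G\<^esub> g \<otimes>\<^bsub>G\<^esub> k = h \<longleftrightarrow> k = g \<otimes>\<^bsub>G\<^esub> h"
      using assms G.inv_solve_left' by metis
    then show ?thesis
      using True assms delta_mult[OF assms(1) delta_closed[OF assms(2)]] by (simp add: delta_def)
  qed (use assms in \<open>auto simp: delta_def mult_outside\<close>)
qed

lemma one_mult: "f \<in> carrier RG \<Longrightarrow> delta R \<one>\<^bsub>G\<^esub> \<otimes>\<^bsub>RG\<^esub> f = f"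
proof
  fix k assume f: "f \<in> carrier RG"
  then show "(delta R \<one>\<^bsub>G\<^esub> \<otimes>\<^bsub>RG\<^esub> f) k = f k"
    using delta_mult[of "\<one>\<^bsub>G\<^esub>" f k] coeff_outside[OF f, of k]
    by (cases "k \<in> carrier G") (auto simp: mult_outside)
qed

lemma mult_one:
  assumes f: "f \<in> carrier RG" shows "f \<otimes>\<^bsub>RG\<^esub> delta R \<one>\<^bsub>G\<^esub> = f"
proof
  fix k
  show "(f \<otimes>\<^bsub>RG\<^esub> delta R \<one>\<^bsub>G\<^esub>) k = f k"
  proof (cases "k \<in> carrier G")
    case k: True
    \<comment> \<open>Inserting \<open>k\<close> keeps the surviving term \<open>h = k\<close> in
      the sum even when \<open>f k\<close> is zero.\<close>
    let ?F = "insert k (supp R f)"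
    have F: "finite ?F" "?F \<subseteq> carrier G" using finite_supp[OF f] supp_subset[OF f] k by auto
    have "(f \<otimes>\<^bsub>RG\<^esub> delta R \<one>\<^bsub>G\<^esub>) k = (\<Oplus>\<^bsub>R\<^esub>h\<in>?F. f h \<otimes>\<^bsub>R\<^esub> delta R \<one>\<^bsub>G\<^esub> (inv\<^bsub>G\<^esub> h \<otimes>\<^bsub>G\<^esub> k))"
      by (rule mult_eq) (use f F k in \<open>auto intro: delta_closed\<close>)
    also have "\<dots> = (\<Oplus>\<^bsub>R\<^esub>h\<in>?F. if h = k then f h else \<zero>\<^bsub>R\<^esub>)"
    proof (rule R.finsum_cong'[OF refl])
      fix h assume "h \<in> ?F"
      then have "h \<in> carrier G" using F by blast
      then have "inv\<^bsub>G\<^esub> h \<otimes>\<^bsub>G\<^esub> k = \<one>\<^bsub>G\<^esub> \<longleftrightarrow> h = k"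
        using k G.inv_solve_left'[of "\<one>\<^bsub>G\<^esub>" h k] by auto
      then show "f h \<otimes>\<^bsub>R\<^esub> delta R \<one>\<^bsub>G\<^esub> (inv\<^bsub>G\<^esub> h \<otimes>\<^bsub>G\<^esub> k) = (if h = k then f h else \<zero>\<^bsub>R\<^esub>)"
        using f by (simp add: delta_def)
    qed (use f in auto)
    also have "\<dots> = f k"
      by (rule R.add.finprod_singleton_swap) (use f F in auto)
    finally show ?thesis .
  qed (use coeff_outside[OF f] in \<open>auto simp: mult_outside\<close>)
qed

section \<open>Module and ring laws of the group algebra\<close>

lemma add_closed:
  assumes "f \<in> carrier RG" "f' \<in> carrier RG" shows "f \<oplus>\<^bsub>RG\<^esub> f' \<in> carrier RG"
  unfolding group_algebra_simps
  by (rule carrierI[of _ "supp R f \<union> supp R f'"])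
    (use assms finite_supp supp_subset in \<open>auto simp: supp_zero\<close>)

lemma smult_closed:
  assumes "r \<in> carrier R" "f \<in> carrier RG" shows "r \<odot>\<^bsub>RG\<^esub> f \<in> carrier RG"
  unfolding group_algebra_simps
  by (rule carrierI[of _ "supp R f"])
    (use assms finite_supp supp_subset in \<open>auto simp: supp_zero\<close>)

lemma zero_closed: "\<zero>\<^bsub>RG\<^esub> \<in> carrier RG"
  unfolding group_algebra_simps by (rule carrierI[of _ "{}"]) auto

lemma abelian_group: "abelian_group RG"
proof (rule abelian_groupI)
  fix f assume f: "f \<in> carrier RG"
  have "(\<ominus>\<^bsub>R\<^esub> \<one>\<^bsub>R\<^esub>) \<odot>\<^bsub>RG\<^esub> f \<oplus>\<^bsub>RG\<^esub> f = \<zero>\<^bsub>RG\<^esub>"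
    using f by (simp add: group_algebra_simps R.l_minus R.l_neg)
  then show "\<exists>f'\<in>carrier RG. f' \<oplus>\<^bsub>RG\<^esub> f = \<zero>\<^bsub>RG\<^esub>"
    using f smult_closed[of "\<ominus>\<^bsub>R\<^esub> \<one>\<^bsub>R\<^esub>" f] by auto
qed (auto simp: add_closed zero_closed, auto simp: group_algebra_simps R.a_ac)

lemma module: "module R RG"
  by (intro moduleI R.is_cring abelian_group smult_closed)
    (auto simp: group_algebra_simps R.l_distr R.r_distr R.m_assoc)

lemma l_distr:
  assumes "f \<in> carrier RG" "f' \<in> carrier RG" "e \<in> carrier RG"
  shows "(f \<oplus>\<^bsub>RG\<^esub> f') \<otimes>\<^bsub>RG\<^esub> e = f \<otimes>\<^bsub>RG\<^esub> e \<oplus>\<^bsub>RG\<^esub> f' \<otimes>\<^bsub>RG\<^esub> e"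
proof
  fix k
  let ?F = "supp R f \<union> supp R f'"
  have F: "finite ?F" using assms finite_supp by simp
  have sub: "supp R (f \<oplus>\<^bsub>RG\<^esub> f') \<subseteq> ?F" by (auto simp: supp_def group_algebra_simps)
  show "((f \<oplus>\<^bsub>RG\<^esub> f') \<otimes>\<^bsub>RG\<^esub> e) k = (f \<otimes>\<^bsub>RG\<^esub> e \<oplus>\<^bsub>RG\<^esub> f' \<otimes>\<^bsub>RG\<^esub> e) k"
  proof (cases "k \<in> carrier G")
    case k: True
    have "((f \<oplus>\<^bsub>RG\<^esub> f') \<otimes>\<^bsub>RG\<^esub> e) k =
        (\<Oplus>\<^bsub>R\<^esub>h\<in>?F. (f \<oplus>\<^bsub>RG\<^esub> f') h \<otimes>\<^bsub>R\<^esub> e (inv\<^bsub>G\<^esub> h \<otimes>\<^bsub>G\<^esub> k))"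
      using assms add_closed F sub k by (intro mult_eq) auto
    also have "\<dots> = (\<Oplus>\<^bsub>R\<^esub>h\<in>?F. f h \<otimes>\<^bsub>R\<^esub> e (inv\<^bsub>G\<^esub> h \<otimes>\<^bsub>G\<^esub> k) \<oplus>\<^bsub>R\<^esub> f' h \<otimes>\<^bsub>R\<^esub> e (inv\<^bsub>G\<^esub> h \<otimes>\<^bsub>G\<^esub> k))"
      by (rule R.finsum_cong') (use assms in \<open>auto simp: group_algebra_simps R.l_distr\<close>)
    also have "\<dots> = (f \<otimes>\<^bsub>RG\<^esub> e) k \<oplus>\<^bsub>R\<^esub> (f' \<otimes>\<^bsub>RG\<^esub> e) k"
      using assms F k mult_eq[of f e ?F k] mult_eq[of f' e ?F k]
      by (subst R.finsum_addf) auto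
    finally show ?thesis by (simp add: group_algebra_simps)
  qed (simp add: mult_outside group_algebra_simps)
qed

lemma r_distr:
  assumes "f \<in> carrier RG" "f' \<in> carrier RG" "e \<in> carrier RG"
  shows "e \<otimes>\<^bsub>RG\<^esub> (f \<oplus>\<^bsub>RG\<^esub> f') = e \<otimes>\<^bsub>RG\<^esub> f \<oplus>\<^bsub>RG\<^esub> e \<otimes>\<^bsub>RG\<^esub> f'"
proof
  fix k
  show "(e \<otimes>\<^bsub>RG\<^esub> (f \<oplus>\<^bsub>RG\<^esub> f')) k = (e \<otimes>\<^bsub>RG\<^esub> f \<oplus>\<^bsub>RG\<^esub> e \<otimes>\<^bsub>RG\<^esub> f') k"
  proof (cases "k \<in> carrier G")
    case k: True
    note eq = mult_eq[OF assms(3) _ finite_supp[OF assms(3)] subset_refl k]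
    have "(e \<otimes>\<^bsub>RG\<^esub> (f \<oplus>\<^bsub>RG\<^esub> f')) k = (\<Oplus>\<^bsub>R\<^esub>h\<in>supp R e. e h \<otimes>\<^bsub>R\<^esub> f (inv\<^bsub>G\<^esub> h \<otimes>\<^bsub>G\<^esub> k) \<oplus>\<^bsub>R\<^esub>
        e h \<otimes>\<^bsub>R\<^esub> f' (inv\<^bsub>G\<^esub> h \<otimes>\<^bsub>G\<^esub> k))"
      unfolding eq[OF add_closed[OF assms(1,2)]]
      by (rule R.finsum_cong') (use assms in \<open>auto simp: group_algebra_simps R.r_distr\<close>)
    also have "\<dots> = (e \<otimes>\<^bsub>RG\<^esub> f) k \<oplus>\<^bsub>R\<^esub> (e \<otimes>\<^bsub>RG\<^esub> f') k"
      unfolding eq[OF assms(1)] eq[OF assms(2)] by (rule R.finsum_addf) (use assms in auto)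
    finally show ?thesis by (simp add: group_algebra_simps)
  qed (simp add: mult_outside group_algebra_simps)
qed

lemma smult_mult_left:
  assumes "r \<in> carrier R" "f \<in> carrier RG" "f' \<in> carrier RG"
  shows "(r \<odot>\<^bsub>RG\<^esub> f) \<otimes>\<^bsub>RG\<^esub> f' = r \<odot>\<^bsub>RG\<^esub> (f \<otimes>\<^bsub>RG\<^esub> f')"
proof
  fix k
  have sub: "supp R (r \<odot>\<^bsub>RG\<^esub> f) \<subseteq> supp R f"
    using assms by (auto simp: supp_def group_algebra_simps)
  show "((r \<odot>\<^bsub>RG\<^esub> f) \<otimes>\<^bsub>RG\<^esub> f') k = (r \<odot>\<^bsub>RG\<^esub> (f \<otimes>\<^bsub>RG\<^esub> f')) k"
  proof (cases "k \<in> carrier G")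
    case k: True
    have "((r \<odot>\<^bsub>RG\<^esub> f) \<otimes>\<^bsub>RG\<^esub> f') k =
        (\<Oplus>\<^bsub>R\<^esub>h\<in>supp R f. (r \<odot>\<^bsub>RG\<^esub> f) h \<otimes>\<^bsub>R\<^esub> f' (inv\<^bsub>G\<^esub> h \<otimes>\<^bsub>G\<^esub> k))"
      using assms smult_closed finite_supp sub k by (intro mult_eq) auto
    also have "\<dots> = (\<Oplus>\<^bsub>R\<^esub>h\<in>supp R f. r \<otimes>\<^bsub>R\<^esub> (f h \<otimes>\<^bsub>R\<^esub> f' (inv\<^bsub>G\<^esub> h \<otimes>\<^bsub>G\<^esub> k)))"
      by (rule R.finsum_cong') (use assms in \<open>auto simp: group_algebra_simps R.m_assoc\<close>)
    also have "\<dots> = r \<otimes>\<^bsub>R\<^esub> (f \<otimes>\<^bsub>RG\<^esub> f') k"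
      unfolding mult_eq[OF assms(2,3) finite_supp[OF assms(2)] subset_refl k]
      by (rule R.finsum_rdistr[symmetric]) (use assms finite_supp in auto)
    finally show ?thesis by (simp add: group_algebra_simps)
  qed (use assms in \<open>simp add: mult_outside group_algebra_simps\<close>)
qed

lemma smult_mult_right:
  assumes "r \<in> carrier R" "f \<in> carrier RG" "f' \<in> carrier RG"
  shows "f \<otimes>\<^bsub>RG\<^esub> (r \<odot>\<^bsub>RG\<^esub> f') = r \<odot>\<^bsub>RG\<^esub> (f \<otimes>\<^bsub>RG\<^esub> f')"
proof
  fix k
  show "(f \<otimes>\<^bsub>RG\<^esub> (r \<odot>\<^bsub>RG\<^esub> f')) k = (r \<odot>\<^bsub>RG\<^esub> (f \<otimes>\<^bsub>RG\<^esub> f')) k"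
  proof (cases "k \<in> carrier G")
    case k: True
    note eq = mult_eq[OF assms(2) _ finite_supp[OF assms(2)] subset_refl k]
    have "(f \<otimes>\<^bsub>RG\<^esub> (r \<odot>\<^bsub>RG\<^esub> f')) k =
        (\<Oplus>\<^bsub>R\<^esub>h\<in>supp R f. r \<otimes>\<^bsub>R\<^esub> (f h \<otimes>\<^bsub>R\<^esub> f' (inv\<^bsub>G\<^esub> h \<otimes>\<^bsub>G\<^esub> k)))"
      unfolding eq[OF smult_closed[OF assms(1,3)]]
      by (rule R.finsum_cong') (use assms in \<open>auto simp: group_algebra_simps R.m_lcomm\<close>)
    also have "\<dots> = r \<otimes>\<^bsub>R\<^esub> (f \<otimes>\<^bsub>RG\<^esub> f') k"
      unfolding eq[OF assms(3)]
      by (rule R.finsum_rdistr[symmetric]) (use assms finite_supp in auto)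
    finally show ?thesis by (simp add: group_algebra_simps)
  qed (use assms in \<open>simp add: mult_outside group_algebra_simps\<close>)
qed

lemma ring: "ring RG"
proof (intro ringI abelian_group monoidI)
  show "\<one>\<^bsub>RG\<^esub> \<in> carrier RG" by (simp add: group_algebra_simps(1) delta_closed)
qed (auto simp: group_algebra_simps(1) mult_closed mult_assoc one_mult mult_one l_distr r_distr)

lemma delta_neq_zero: "\<one>\<^bsub>R\<^esub> \<noteq> \<zero>\<^bsub>R\<^esub> \<Longrightarrow> delta R g \<noteq> \<zero>\<^bsub>RG\<^esub>"
  by (auto simp: group_algebra_simps(2) delta_def fun_eq_iff)

lemma unital_algebra:
  assumes "\<one>\<^bsub>R\<^esub> \<noteq> \<zero>\<^bsub>R\<^esub>" shows "unital_algebra R RG"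
  using delta_neq_zero[OF assms]
  by (intro unital_algebra.intro module ring unital_algebra_axioms.intro smult_mult_left smult_mult_right)
    (simp_all add: group_algebra_simps(1))

section \<open>The grading of the group algebra\<close>

lemma finsum_coeff:
  assumes "F \<in> I \<rightarrow> carrier RG" shows "(\<Oplus>\<^bsub>RG\<^esub>i\<in>I. F i) k = (\<Oplus>\<^bsub>R\<^esub>i\<in>I. F i k)"
  by (rule finsum_additive[of RG R "\<lambda>f. f k"])
    (use assms abelian_group.axioms(1)[OF abelian_group] R.abelian_monoid_axioms
      in \<open>auto simp: group_algebra_simps\<close>)

text \<open>The part of \<open>x\<close> in degree \<open>g\<close> is \<open>x\<close> cut down to
  the single point \<open>g\<close>. As an equivalence, this gives existence and uniqueness in one
  statement.\<close>

lemma homogeneous_decomposition_iff: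
  assumes x: "x \<in> carrier RG"
  shows "homogeneous_decomposition G RG grad x F \<longleftrightarrow>
    F = (\<lambda>g k. if k = g then x g else \<zero>\<^bsub>R\<^esub>)" (is "_ \<longleftrightarrow> F = ?F")
proof
  assume F: "homogeneous_decomposition G RG grad x F"
  let ?S = "{g. F g \<noteq> \<zero>\<^bsub>RG\<^esub>}"
  have FG: "F g \<in> grad g" if "g \<in> carrier G" for g
    using F that unfolding homogeneous_decomposition_def by blast
  have out: "F g = \<zero>\<^bsub>RG\<^esub>" if "g \<notin> carrier G" for g
    using F that unfolding homogeneous_decomposition_def by blast
  have cl: "F g \<in> carrier RG" for g
    using FG[of g] out[of g] zero_closed by (cases "g \<in> carrier G") (auto simp: group_algebra_grading_def)
  have diag: "F g k = \<zero>\<^bsub>R\<^esub>" if "k \<noteq> g" for g k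
    using FG[of g] out[of g] that
    by (cases "g \<in> carrier G") (auto simp: group_algebra_grading_def supp_def group_algebra_simps)
  have "x k = F k k" for k
  proof -
    \<comment> \<open>\<open>k\<close> need not belong to \<open>?S\<close>, since
      \<open>F k\<close> may be zero; after insertion, evaluation at \<open>k\<close> leaves exactly
      the term of index \<open>k\<close>.\<close>
    have fin: "finite (insert k ?S)" and "x = (\<Oplus>\<^bsub>RG\<^esub>g\<in>?S. F g)"
      using F unfolding homogeneous_decomposition_def by auto
    then have "x k = (\<Oplus>\<^bsub>R\<^esub>g\<in>?S. F g k)"
      using finsum_coeff[of F ?S k] cl by simp
    also have "\<dots> = (\<Oplus>\<^bsub>R\<^esub>g\<in>insert k ?S. F g k)"
      by (rule R.finsum_mono_neutral_left) (use fin cl in \<open>auto simp: group_algebra_simps\<close>)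
    also have "\<dots> = (\<Oplus>\<^bsub>R\<^esub>g\<in>insert k ?S. if g = k then F g k else \<zero>\<^bsub>R\<^esub>)"
      by (rule R.finsum_cong') (use cl diag in auto)
    also have "\<dots> = F k k"
      by (rule R.add.finprod_singleton_swap) (use fin cl in auto)
    finally show ?thesis .
  qed
  then show "F = ?F" using diag by (auto simp: fun_eq_iff)
next
  assume F: "F = ?F"
  have supp: "{g. F g \<noteq> \<zero>\<^bsub>RG\<^esub>} = supp R x"
    by (auto simp: F supp_def group_algebra_simps fun_eq_iff)
  have cl: "F g \<in> carrier RG" for g
    unfolding F by (rule carrierI[of _ "supp R x"])
      (use x finite_supp supp_subset in \<open>auto simp: supp_zero\<close>)
  have "x = (\<Oplus>\<^bsub>RG\<^esub>g\<in>supp R x. F g)"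
  proof
    fix k
    have "x k = (\<Oplus>\<^bsub>R\<^esub>g\<in>insert k (supp R x). if g = k then x g else \<zero>\<^bsub>R\<^esub>)"
      by (rule R.add.finprod_singleton_swap[symmetric]) (use x finite_supp in auto)
    also have "\<dots> = (\<Oplus>\<^bsub>R\<^esub>g\<in>insert k (supp R x). F g k)"
      by (rule R.finsum_cong') (use x in \<open>auto simp: F\<close>)
    also have "\<dots> = (\<Oplus>\<^bsub>R\<^esub>g\<in>supp R x. F g k)"
      by (rule R.finsum_mono_neutral_left[symmetric])
        (use x finite_supp in \<open>auto simp: F supp_zero\<close>)
    finally show "x k = (\<Oplus>\<^bsub>RG\<^esub>g\<in>supp R x. F g) k"
      using finsum_coeff[of F "supp R x" k] cl by simp
  qed
  moreover have "F g \<in> grad g" for g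
    using cl[of g] by (auto simp: group_algebra_grading_def F supp_def split: if_splits)
  moreover have "F g = \<zero>\<^bsub>RG\<^esub>" if "g \<notin> carrier G" for g
    using supp supp_subset[OF x] that by auto
  ultimately show "homogeneous_decomposition G RG grad x F"
    unfolding homogeneous_decomposition_def supp using finite_supp[OF x] by auto
qed

lemma graded_group_algebra:
  assumes "\<one>\<^bsub>R\<^esub> \<noteq> \<zero>\<^bsub>R\<^esub>" shows "graded_algebra G R RG grad"
proof (intro graded_algebra.intro G.is_group unital_algebra assms graded_algebra_axioms.intro)
  fix g assume "g \<in> carrier G"
  show "submodule (grad g) R RG"
  proof (rule module.submoduleI'[OF module])
    fix x y assume "x \<in> grad g" "y \<in> grad g"
    moreover then have "supp R (x \<oplus>\<^bsub>RG\<^esub> y) \<subseteq> supp R x \<union> supp R y"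
      by (auto simp: supp_def group_algebra_simps)
    ultimately show "x \<oplus>\<^bsub>RG\<^esub> y \<in> grad g"
      by (auto simp: group_algebra_grading_def add_closed)
  next
    fix r x assume r: "r \<in> carrier R" and "x \<in> grad g"
    moreover have "supp R (r \<odot>\<^bsub>RG\<^esub> x) \<subseteq> supp R x"
      using r by (auto simp: supp_def group_algebra_simps)
    ultimately show "r \<odot>\<^bsub>RG\<^esub> x \<in> grad g"
      by (auto simp: group_algebra_grading_def smult_closed)
  qed (auto simp: group_algebra_grading_def zero_closed, auto simp: supp_def group_algebra_simps)
next
  fix x assume "x \<in> carrier RG"
  then show "\<exists>!F. homogeneous_decomposition G RG grad x F"
    by (simp add: homogeneous_decomposition_iff)
next
  fix g h x y assume "g \<in> carrier G" "h \<in> carrier G" "x \<in> grad g" "y \<in> grad h"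
  then show "x \<otimes>\<^bsub>RG\<^esub> y \<in> grad (g \<otimes>\<^bsub>G\<^esub> h)"
    using mult_zero_outside[of x "{g}" y "{h}"] mult_closed
    by (auto simp: group_algebra_grading_def supp_def)
qed

lemma delta_homogeneous: "g \<in> carrier G \<Longrightarrow> delta R g \<in> grad g"
  by (auto simp: group_algebra_grading_def delta_closed) (auto simp: supp_def delta_def split: if_splits)

text \<open>The unit \<open>e\<close> is arbitrary; it enters only through its degree and through
  being nonzero.\<close>

theorem ring_supporting_if_group_algebra_restriction:
  assumes nz: "\<one>\<^bsub>R\<^esub> \<noteq> \<zero>\<^bsub>R\<^esub>" and U: "U \<subseteq> carrier G"
    and gr: "graded_algebra G R (support_restriction G RG grad U e) (restricted_grading RG grad U)"
  shows "ring_supporting G U"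
proof -
  let ?B = "support_restriction G RG grad U e"
  interpret A: grading G R RG grad by (rule gradingI[OF graded_group_algebra[OF nz]])
  interpret B: grading G R ?B "restricted_grading RG grad U" by (rule gradingI[OF gr])
  \<comment> \<open>Otherwise the component of neutral degree in \<open>?B\<close> would be zero,
    and with it the unit \<open>e\<close>.\<close>
  have one: "\<one>\<^bsub>G\<^esub> \<in> U"
    using B.one_homogeneous B.one_neq_zero by (auto simp: restricted_grading_def split: if_splits)
  have mem: "delta R u \<in> carrier ?B" if "u \<in> U" for u
    using that U delta_homogeneous delta_closed A.hom_comp_homogeneous[of u "delta R u"]
    by (auto simp: A.restricted_carrier_iff)
  have mult: "delta R g \<otimes>\<^bsub>?B\<^esub> delta R h =
      (if g \<otimes>\<^bsub>G\<^esub> h \<in> U then delta R (g \<otimes>\<^bsub>G\<^esub> h) else \<zero>\<^bsub>RG\<^esub>)"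
    if "g \<in> carrier G" "h \<in> carrier G" for g h
    using that A.proj_homogeneous[of "g \<otimes>\<^bsub>G\<^esub> h" "delta R (g \<otimes>\<^bsub>G\<^esub> h)"] delta_homogeneous
    by (simp add: A.restricted_mult_eq_proj delta_closed delta_mult_delta)
  show ?thesis
    unfolding ring_supporting_def
  proof (intro conjI one ballI impI)
    fix u v w assume uvw: "u \<in> U" "v \<in> U" "w \<in> U" and p: "u \<otimes>\<^bsub>G\<^esub> v \<otimes>\<^bsub>G\<^esub> w \<in> U"
    then have G: "u \<in> carrier G" "v \<in> carrier G" "w \<in> carrier G" using U by auto
    have "delta R u \<otimes>\<^bsub>?B\<^esub> delta R v \<otimes>\<^bsub>?B\<^esub> delta R w = delta R u \<otimes>\<^bsub>?B\<^esub> (delta R v \<otimes>\<^bsub>?B\<^esub> delta R w)"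
      by (intro B.A.m_assoc mem uvw)
    \<comment> \<open>As uvw lies in \<open>U\<close>, the last multiplication discards nothing, and
      the value records exactly whether uv lies in \<open>U\<close>; the other bracketing does the
      same for vw.\<close>
    moreover have "delta R u \<otimes>\<^bsub>?B\<^esub> delta R v \<otimes>\<^bsub>?B\<^esub> delta R w =
        (if u \<otimes>\<^bsub>G\<^esub> v \<in> U then delta R (u \<otimes>\<^bsub>G\<^esub> v \<otimes>\<^bsub>G\<^esub> w) else \<zero>\<^bsub>RG\<^esub>)"
      using G p B.A.l_null[OF mem[OF uvw(3)]] mult[of u v] mult[of "u \<otimes>\<^bsub>G\<^esub> v" w] by simp
    moreover have "delta R u \<otimes>\<^bsub>?B\<^esub> (delta R v \<otimes>\<^bsub>?B\<^esub> delta R w) =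
        (if v \<otimes>\<^bsub>G\<^esub> w \<in> U then delta R (u \<otimes>\<^bsub>G\<^esub> v \<otimes>\<^bsub>G\<^esub> w) else \<zero>\<^bsub>RG\<^esub>)"
      using G p B.A.r_null[OF mem[OF uvw(1)]] mult[of v w] mult[of u "v \<otimes>\<^bsub>G\<^esub> w"]
      by (simp add: G.m_assoc)
    \<comment> \<open>The basis element at uvw is nonzero, so the two conditionals agree only if
      their conditions do.\<close>
    ultimately show "u \<otimes>\<^bsub>G\<^esub> v \<in> U \<longleftrightarrow> v \<otimes>\<^bsub>G\<^esub> w \<in> U"
      using delta_neq_zero[OF nz, of "u \<otimes>\<^bsub>G\<^esub> v \<otimes>\<^bsub>G\<^esub> w"] by (auto split: if_splits)
  qed
qed

end

text \<open>The type \<open>'g \<Rightarrow> 'r\<close> is the one that carries R[G], so quantifying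
  over algebras on it is enough for the converse. The second conjunct gives the forward direction on
  an arbitrary type \<open>'a\<close>, because a formula cannot quantify over all types at
  once.\<close>

theorem proposition2p2:
  fixes G :: "('g, 'm) monoid_scheme" and R :: "('r, 'n) ring_scheme" and U :: "'g set"
  assumes "group G" and "cring R" and "\<one>\<^bsub>R\<^esub> \<noteq> \<zero>\<^bsub>R\<^esub>" and "U \<subseteq> carrier G"
  shows "(ring_supporting G U \<longleftrightarrow> restrictions_graded TYPE('g \<Rightarrow> 'r) G R U) \<and>
    (ring_supporting G U \<longrightarrow> restrictions_graded TYPE('a) G R U)"
proof (intro conjI iffI impI)
  assume "ring_supporting G U"
  then show "restrictions_graded TYPE('g \<Rightarrow> 'r) G R U" "restrictions_graded TYPE('a) G R U"
    using graded_support_restriction assms(4) unfolding restrictions_graded_def by blast+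
next
  interpret group_algebra_base G R using assms(1,2) by (rule group_algebra_base.intro)
  assume "restrictions_graded TYPE('g \<Rightarrow> 'r) G R U"
  then show "ring_supporting G U"
    using graded_group_algebra[OF assms(3)] ring_supporting_if_group_algebra_restriction[OF assms(3,4)]
    unfolding restrictions_graded_def by blast
qed

end
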